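(* Let $n\ge 1$, let $\mathcal{C}_X=(X,\{X_i\}_{1\le i\le n})$ and $\mathcal{C}_Y=(Y,\{Y_i\}_{1\le i\le n})$ be $n$-interaction spaces, and let $f,g:\mathcal{C}_X\to\mathcal{C}_Y$ be morphisms of interaction spaces. If $f$ and $g$ are homotopic, then the induced maps on interaction singular homology agree: $H_*(f)=H_*(g): H_*(\{X_i\}_{1\le i\le n})\to H_*(\{Y_i\}_{1\le i\le n})$.
   Context: An $n$-interaction space $(X,\{X_i\}_{1\le i\le n})$ is a topological space $X$ with a covering $\{X_i\}_{1\le i\le n}$ of $X$ by subspaces; it is also written $\{X_i\}_{1\le i\le n}$. A morphism of $n$-interaction spaces $f=\{f_i\}_{1\le i\le n}:(X,\{X_i\})\to(Y,\{Y_i\})$ is a family of continuous maps $f_i:X_i\to Y_i$ such that for any $1\le i,j\le n$ and any $x_i\in X_i$, $x_j\in X_j$: $f_i(x_i)=f_j(x_j)$ if and only if $x_i=x_j$. With $I=[0,1]$, morphisms $f,g:(X,\{X_i\})\to(Y,\{Y_i\})$ are formal homotopic, $f\simeq g$, if there is a morphism of interaction spaces $H=\{H_i\}:(X\times I,\{X_i\times I\})\to(Y,\{Y_i\})$ with $H_i(x,0)=f_i(x)$ and $H_i(x,1)=g_i(x)$ for all $i$ and $x\in X_i$. They are homotopic, $f\sim g$, if there is a finite chain of formal homotopies $f\simeq f_1\simeq\cdots\simeq f_k\simeq g$ connecting them. The ground ring $R$ is a principal ideal domain and $\otimes=\otimes_R$. Let $S_*(X)$ be the singular chain complex of $X$ over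 $R$. The tensor product $\bigotimes_{i=1}^n S_*(X_i)$ is a chain complex with differential $d(\sigma_1\otimes\cdots\otimes\sigma_n)=\sum_{i=1}^n(-1)^{\dim\sigma_1+\cdots+\dim\sigma_{i-1}}\sigma_1\otimes\cdots\otimes d\sigma_i\otimes\cdots\otimes\sigma_n$. Let $T_*(\{X_i\})$ be the subcomplex generated as an $R$-module by the elements $\sigma_1\otimes\cdots\otimes\sigma_n$, with $\sigma_i$ a singular simplex of $X_i$, such that $\bigcap_{i=1}^n\mathrm{im}\,\sigma_i=\emptyset$. The interaction singular chain complex is $IS_*(\{X_i\})=\left(\bigotimes_{i=1}^n S_*(X_i)\right)/T_*(\{X_i\})$, and the interaction singular homology is $H_p(\{X_i\})=H_p(IS_*(\{X_i\}))$, $p\ge 0$. A morphism $f=\{f_i\}$ induces the chain map $f^\sharp=\bigotimes_i f_i^\sharp:\bigotimes_i S_*(X_i)\to\bigotimes_i S_*(Y_i)$, which descends to a chain map $\bar f:IS_*(\{X_i\})\to IS_*(\{Y_i\})$; $H_*(f)$ is the map induced by $\bar f$ on homology. *)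

theory Defs
  imports "HOL-Homology.Homology" "HOL-Library.Poly_Mapping"
begin

section \<open>Interaction spaces, morphisms and homotopy\<close>

definition interaction_space :: "nat \<Rightarrow> 'a topology \<Rightarrow> (nat \<Rightarrow> 'a set) \<Rightarrow> bool" where
  "interaction_space n X A \<longleftrightarrow> topspace X = (\<Union>i\<in>{1..n}. A i)"

text \<open>Only the values of \<^term>\<open>f i\<close> on \<^term>\<open>A i\<close> (for \<open>1 \<le> i \<le> n\<close>) are meaningful.
  Taking \<open>i = j\<close> in the second condition shows that each component is injective.\<close>

definition interaction_morphism ::
  "nat \<Rightarrow> 'a topology \<Rightarrow> (nat \<Rightarrow> 'a set) \<Rightarrow> 'b topology \<Rightarrow> (nat \<Rightarrow> 'b set) \<Rightarrow> (nat \<Rightarrow> 'a \<Rightarrow> 'b) \<Rightarrow> bool"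
where
  "interaction_morphism n X A Y B f \<longleftrightarrow>
     (\<forall>i\<in>{1..n}. continuous_map (subtopology X (A i)) (subtopology Y (B i)) (f i)) \<and>
     (\<forall>i\<in>{1..n}. \<forall>j\<in>{1..n}. \<forall>x\<in>A i. \<forall>y\<in>A j. f i x = f j y \<longleftrightarrow> x = y)"

definition formal_homotopic ::
  "nat \<Rightarrow> 'a topology \<Rightarrow> (nat \<Rightarrow> 'a set) \<Rightarrow> 'b topology \<Rightarrow> (nat \<Rightarrow> 'b set) \<Rightarrow>
   (nat \<Rightarrow> 'a \<Rightarrow> 'b) \<Rightarrow> (nat \<Rightarrow> 'a \<Rightarrow> 'b) \<Rightarrow> bool"
where
  "formal_homotopic n X A Y B f g \<longleftrightarrow>
     interaction_morphism n X A Y B f \<and> interaction_morphism n X A Y B g \<and>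
     (\<exists>H. interaction_morphism n (prod_topology X (top_of_set {0..1::real})) (\<lambda>i. A i \<times> {0..1}) Y B H \<and>
          (\<forall>i\<in>{1..n}. \<forall>x\<in>A i. H i (x, 0) = f i x \<and> H i (x, 1) = g i x))"

definition interaction_homotopic ::
  "nat \<Rightarrow> 'a topology \<Rightarrow> (nat \<Rightarrow> 'a set) \<Rightarrow> 'b topology \<Rightarrow> (nat \<Rightarrow> 'b set) \<Rightarrow>
   (nat \<Rightarrow> 'a \<Rightarrow> 'b) \<Rightarrow> (nat \<Rightarrow> 'a \<Rightarrow> 'b) \<Rightarrow> bool"
where
  "interaction_homotopic n X A Y B = (formal_homotopic n X A Y B)\<^sup>+\<^sup>+"


section \<open>Free modules over a principal ideal domain and their tensor products\<close>

class principal_ideal_domain = idom +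
  assumes ideal_principal:
    "\<lbrakk>0 \<in> J; \<And>x y. x \<in> J \<Longrightarrow> y \<in> J \<Longrightarrow> x + y \<in> J; \<And>r x. x \<in> J \<Longrightarrow> r * x \<in> J\<rbrakk>
     \<Longrightarrow> \<exists>a. J = {r * a |r. True}"

definition smult_pm :: "'r::comm_ring_1 \<Rightarrow> ('b \<Rightarrow>\<^sub>0 'r) \<Rightarrow> ('b \<Rightarrow>\<^sub>0 'r)" where
  "smult_pm r c = Poly_Mapping.map ((*) r) c"

lemma lookup_smult_pm [simp]: "Poly_Mapping.lookup (smult_pm r c) k = r * Poly_Mapping.lookup c k"
  by (auto simp: smult_pm_def Poly_Mapping.map.rep_eq when_def)

global_interpretation pm: Modules.module smult_pm
  by standard (auto intro!: poly_mapping_eqI simp: lookup_add algebra_simps)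

definition free_on :: "'b set \<Rightarrow> ('b \<Rightarrow>\<^sub>0 'r::comm_ring_1) set" where
  "free_on S = {c. Poly_Mapping.keys c \<subseteq> S}"

definition linear_extension :: "('b \<Rightarrow> ('c \<Rightarrow>\<^sub>0 'r)) \<Rightarrow> ('b \<Rightarrow>\<^sub>0 'r::comm_ring_1) \<Rightarrow> ('c \<Rightarrow>\<^sub>0 'r)" where
  "linear_extension \<phi> c = (\<Sum>b\<in>Poly_Mapping.keys c. smult_pm (Poly_Mapping.lookup c b) (\<phi> b))"

text \<open>The tensor product of the free modules on \<open>S\<^sub>1, \<dots>, S\<^sub>n\<close> is realised as the free module on
  \<open>S\<^sub>1 \<times> \<dots> \<times> S\<^sub>n\<close>, together with the multilinear map \<open>(c\<^sub>1, \<dots>, c\<^sub>n) \<mapsto> c\<^sub>1 \<otimes> \<dots> \<otimes> c\<^sub>n\<close> below;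
  its universal property is \<open>tensor_universal\<close>.\<close>

definition tensor :: "nat \<Rightarrow> (nat \<Rightarrow> ('b \<Rightarrow>\<^sub>0 'r::comm_ring_1)) \<Rightarrow> ((nat \<Rightarrow> 'b) \<Rightarrow>\<^sub>0 'r)" where
  "tensor n c = (\<Sum>\<tau>\<in>(\<Pi>\<^sub>E i\<in>{1..n}. Poly_Mapping.keys (c i)).
     Poly_Mapping.single \<tau> (\<Prod>i\<in>{1..n}. Poly_Mapping.lookup (c i) (\<tau> i)))"

definition multilinear_on ::
  "nat \<Rightarrow> (nat \<Rightarrow> ('b \<Rightarrow>\<^sub>0 'r::comm_ring_1) set) \<Rightarrow> ('r \<Rightarrow> 'm::ab_group_add \<Rightarrow> 'm) \<Rightarrow>
   ((nat \<Rightarrow> ('b \<Rightarrow>\<^sub>0 'r)) \<Rightarrow> 'm) \<Rightarrow> bool"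
where
  "multilinear_on n M sc \<phi> \<longleftrightarrow>
     (\<forall>c\<in>Pi\<^sub>E {1..n} M. \<forall>i\<in>{1..n}.
        (\<forall>x\<in>M i. \<forall>y\<in>M i. \<phi> (c(i := x + y)) = \<phi> (c(i := x)) + \<phi> (c(i := y))) \<and>
        (\<forall>r. \<forall>x\<in>M i. \<phi> (c(i := smult_pm r x)) = sc r (\<phi> (c(i := x)))))"

lemma lookup_tensor:
  "Poly_Mapping.lookup (tensor n c) \<tau> = (if \<tau> \<in> extensional {1..n} then \<Prod>i\<in>{1..n}. Poly_Mapping.lookup (c i) (\<tau> i) else 0)"
proof -
  have fin: "finite (\<Pi>\<^sub>E i\<in>{1..n}. Poly_Mapping.keys (c i))"
    by (intro finite_PiE) auto
  have "Poly_Mapping.lookup (tensor n c) \<tau> =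
      (if \<tau> \<in> (\<Pi>\<^sub>E i\<in>{1..n}. Poly_Mapping.keys (c i)) then \<Prod>i\<in>{1..n}. Poly_Mapping.lookup (c i) (\<tau> i) else 0)"
    using fin by (simp add: tensor_def lookup_sum lookup_single when_def sum.delta)
  also have "\<dots> = (if \<tau> \<in> extensional {1..n} then \<Prod>i\<in>{1..n}. Poly_Mapping.lookup (c i) (\<tau> i) else 0)"
  proof (cases "\<tau> \<in> extensional {1..n} \<and> (\<exists>i\<in>{1..n}. Poly_Mapping.lookup (c i) (\<tau> i) = 0)")
    case True
    then obtain i where "i \<in> {1..n}" "Poly_Mapping.lookup (c i) (\<tau> i) = 0" by blast
    then have "(\<Prod>i\<in>{1..n}. Poly_Mapping.lookup (c i) (\<tau> i)) = 0"
      by (intro prod_zero) auto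
    then show ?thesis by simp
  next
    case False
    then show ?thesis by (auto simp: PiE_iff in_keys_iff)
  qed
  finally show ?thesis .
qed

lemma tensor_in_free_on:
  assumes "\<And>i. i \<in> {1..n} \<Longrightarrow> c i \<in> free_on (S i)"
  shows "tensor n c \<in> free_on (Pi\<^sub>E {1..n} S)"
proof -
  have "\<tau> \<in> Pi\<^sub>E {1..n} S" if "Poly_Mapping.lookup (tensor n c) \<tau> \<noteq> 0" for \<tau>
  proof -
    have ext: "\<tau> \<in> extensional {1..n}" and nz: "(\<Prod>i\<in>{1..n}. Poly_Mapping.lookup (c i) (\<tau> i)) \<noteq> 0"
      using that by (auto simp: lookup_tensor split: if_splits)
    have "Poly_Mapping.lookup (c i) (\<tau> i) \<noteq> 0" if "i \<in> {1..n}" for i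
      using nz that by (metis finite_atLeastAtMost prod_zero)
    with ext assms show ?thesis
      by (auto simp: PiE_iff free_on_def in_keys_iff subset_iff)
  qed
  then show ?thesis by (auto simp: free_on_def in_keys_iff)
qed

lemma multilinear_on_tensor:
  fixes M :: "nat \<Rightarrow> ('b \<Rightarrow>\<^sub>0 'r::comm_ring_1) set"
  shows "multilinear_on n M smult_pm (tensor n)"
proof -
  have split: "(\<Prod>j\<in>{1..n}. Poly_Mapping.lookup ((c(i := x)) j) (\<tau> j)) =
      Poly_Mapping.lookup x (\<tau> i) * (\<Prod>j\<in>{1..n} - {i}. Poly_Mapping.lookup (c j) (\<tau> j))"
    if "i \<in> {1..n}" for c :: "nat \<Rightarrow> ('b \<Rightarrow>\<^sub>0 'r)" and i x \<tau>
    using that by (subst prod.remove[of _ i]) (auto intro!: prod.cong)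
  show ?thesis
    unfolding multilinear_on_def
    by (intro ballI conjI allI poly_mapping_eqI)
       (simp_all only: lookup_tensor lookup_add lookup_smult_pm split,
        simp_all add: algebra_simps)
qed

lemma free_on_span:
  fixes S :: "'b set"
  shows "(free_on S :: ('b \<Rightarrow>\<^sub>0 'r::comm_ring_1) set) = pm.span ((\<lambda>b. Poly_Mapping.single b 1) ` S)"
proof (rule pm.span_subspace[symmetric])
  show "(\<lambda>b. Poly_Mapping.single b 1) ` S \<subseteq> (free_on S :: ('b \<Rightarrow>\<^sub>0 'r) set)"
    by (auto simp: free_on_def)
  show "pm.subspace (free_on S :: ('b \<Rightarrow>\<^sub>0 'r) set)"
  proof (rule pm.subspaceI)
    fix x y :: "'b \<Rightarrow>\<^sub>0 'r" and r :: 'r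
    assume x: "x \<in> free_on S"
    have "Poly_Mapping.keys (smult_pm r x) \<subseteq> Poly_Mapping.keys x"
      by (auto simp: in_keys_iff)
    then show "smult_pm r x \<in> free_on S"
      using x by (auto simp: free_on_def)
    assume "y \<in> free_on S"
    then show "x + y \<in> free_on S"
      using x Poly_Mapping.keys_add[of x y] by (auto simp: free_on_def)
  qed (simp add: free_on_def)
  show "(free_on S :: ('b \<Rightarrow>\<^sub>0 'r) set) \<subseteq> pm.span ((\<lambda>b. Poly_Mapping.single b 1) ` S)"
  proof
    fix c :: "'b \<Rightarrow>\<^sub>0 'r" assume c: "c \<in> free_on S"
    let ?s = "\<Sum>b\<in>Poly_Mapping.keys c. smult_pm (Poly_Mapping.lookup c b) (Poly_Mapping.single b 1)"
    have "?s \<in> pm.span ((\<lambda>b. Poly_Mapping.single b 1) ` S)"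
      using c by (intro pm.span_sum pm.span_scale pm.span_base) (auto simp: free_on_def)
    moreover have "?s = c"
    proof (rule poly_mapping_eqI)
      fix k
      have "Poly_Mapping.lookup ?s k =
          (\<Sum>b\<in>Poly_Mapping.keys c. if b = k then Poly_Mapping.lookup c b else 0)"
        unfolding lookup_sum by (intro sum.cong) (auto simp: lookup_single when_def)
      also have "\<dots> = Poly_Mapping.lookup c k"
        by (auto simp: in_keys_iff)
      finally show "Poly_Mapping.lookup ?s k = Poly_Mapping.lookup c k" .
    qed
    ultimately show "c \<in> pm.span ((\<lambda>b. Poly_Mapping.single b 1) ` S)" by metis
  qed
qed

lemma tensor_single:
  "tensor n (\<lambda>i\<in>{1..n}. Poly_Mapping.single (\<tau> i) 1) =
   Poly_Mapping.single (restrict \<tau> {1..n}) (1 :: 'r::comm_ring_1)"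
proof (rule poly_mapping_eqI)
  fix \<rho>
  have "(\<Prod>i\<in>{1..n}. Poly_Mapping.lookup ((\<lambda>i\<in>{1..n}. Poly_Mapping.single (\<tau> i) (1::'r)) i) (\<rho> i)) =
      (if \<forall>i\<in>{1..n}. \<tau> i = \<rho> i then 1 else 0)"
  proof (cases "\<forall>i\<in>{1..n}. \<tau> i = \<rho> i")
    case False
    then show ?thesis
      by (subst if_not_P, assumption, intro prod_zero) (auto simp: lookup_single when_def)
  qed (auto simp: lookup_single)
  moreover have "restrict \<tau> {1..n} = \<rho> \<longleftrightarrow> \<rho> \<in> extensional {1..n} \<and> (\<forall>i\<in>{1..n}. \<tau> i = \<rho> i)"
    by (auto simp: extensional_def restrict_def fun_eq_iff)
  ultimately show "Poly_Mapping.lookup (tensor n (\<lambda>i\<in>{1..n}. Poly_Mapping.single (\<tau> i) (1::'r))) \<rho> =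
      Poly_Mapping.lookup (Poly_Mapping.single (restrict \<tau> {1..n}) 1) \<rho>"
    by (simp add: lookup_tensor lookup_single when_def)
qed

lemma multilinear_on_eqI:
  fixes sc :: "'r::comm_ring_1 \<Rightarrow> 'm::ab_group_add \<Rightarrow> 'm"
    and S :: "nat \<Rightarrow> 'b set"
  assumes "Modules.module sc"
    and \<phi>: "multilinear_on n (\<lambda>i. free_on (S i)) sc \<phi>"
    and \<psi>: "multilinear_on n (\<lambda>i. free_on (S i)) sc \<psi>"
    and basis: "\<And>\<tau>. \<tau> \<in> Pi\<^sub>E {1..n} S \<Longrightarrow>
       \<phi> (\<lambda>i\<in>{1..n}. Poly_Mapping.single (\<tau> i) 1) = \<psi> (\<lambda>i\<in>{1..n}. Poly_Mapping.single (\<tau> i) 1)"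
    and "c \<in> (\<Pi>\<^sub>E i\<in>{1..n}. free_on (S i))"
  shows "\<phi> c = \<psi> c"
proof -
  interpret Modules.module sc by fact
  define B where "B i = (\<lambda>b. Poly_Mapping.single b (1::'r)) ` S i" for i
  have "\<phi> c = \<psi> c"
    if "c \<in> (\<Pi>\<^sub>E i\<in>{1..n}. free_on (S i))" "\<And>i. i \<in> {1..n} \<Longrightarrow> k < i \<Longrightarrow> c i \<in> B i" for k c
    using that
  proof (induction k arbitrary: c)
    case 0
    then have "\<forall>i\<in>{1..n}. \<exists>b\<in>S i. c i = Poly_Mapping.single b 1"
      unfolding B_def image_iff by fastforce
    then obtain \<tau> where \<tau>: "\<And>i. i \<in> {1..n} \<Longrightarrow> \<tau> i \<in> S i \<and> c i = Poly_Mapping.single (\<tau> i) 1"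
      by metis
    have "c = (\<lambda>i\<in>{1..n}. Poly_Mapping.single (restrict \<tau> {1..n} i) 1)"
      using 0(1) \<tau> by (auto simp: PiE_iff extensional_def fun_eq_iff)
    moreover have "restrict \<tau> {1..n} \<in> Pi\<^sub>E {1..n} S" using \<tau> by auto
    note basis[OF this]
    ultimately show ?case by (simp only:)
  next
    case (Suc k)
    show ?case
    proof (cases "Suc k \<in> {1..n}")
      case False
      show ?thesis
      proof (rule Suc.IH[OF Suc.prems(1)])
        fix i assume i: "i \<in> {1..n}" "k < i"
        with False have "Suc k < i" by (cases "i = Suc k") auto
        then show "c i \<in> B i" using Suc.prems(2) i by blast
      qed
    next
      case True
      have upd: "c(Suc k := x) \<in> (\<Pi>\<^sub>E i\<in>{1..n}. free_on (S i))" if "x \<in> free_on (S (Suc k))" for x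
        using Suc.prems(1) True that by (auto simp: PiE_iff extensional_def)
      have "x \<in> free_on (S (Suc k)) \<and> \<phi> (c(Suc k := x)) = \<psi> (c(Suc k := x))"
        if x: "x \<in> pm.span (B (Suc k))" for x
        using x
      proof (induction rule: pm.span_induct_alt)
        case base
        have z: "(0 :: 'b \<Rightarrow>\<^sub>0 'r) \<in> free_on (S (Suc k))" by (simp add: free_on_def)
        have "\<phi> (c(Suc k := smult_pm 0 0)) = sc 0 (\<phi> (c(Suc k := 0)))"
          using \<phi> Suc.prems(1) True z unfolding multilinear_on_def by blast
        moreover have "\<psi> (c(Suc k := smult_pm 0 0)) = sc 0 (\<psi> (c(Suc k := 0)))"
          using \<psi> Suc.prems(1) True z unfolding multilinear_on_def by blast
        ultimately show ?case using z by (simp only: pm.scale_zero_right scale_zero_left)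
      next
        case (step r b y)
        have b: "b \<in> free_on (S (Suc k))"
          using step(1) unfolding free_on_span B_def by (rule pm.span_base)
        have y: "y \<in> free_on (S (Suc k))" using step by blast
        have rb: "smult_pm r b \<in> free_on (S (Suc k))"
          using b unfolding free_on_span by (rule pm.span_scale)
        have rby: "smult_pm r b + y \<in> free_on (S (Suc k))"
          using rb y unfolding free_on_span by (rule pm.span_add)
        have eq: "\<phi> (c(Suc k := b)) = \<psi> (c(Suc k := b))"
        proof (rule Suc.IH)
          show "(c(Suc k := b)) i \<in> B i" if "i \<in> {1..n}" "k < i" for i
            using that step(1) Suc.prems(2)[of i] by auto
        qed (rule upd[OF b])
        have lin: "\<theta> (c(Suc k := smult_pm r b + y)) = sc r (\<theta> (c(Suc k := b))) + \<theta> (c(Suc k := y))"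
          if "multilinear_on n (\<lambda>i. free_on (S i)) sc \<theta>" for \<theta>
        proof -
          have "\<theta> (c(Suc k := smult_pm r b + y)) = \<theta> (c(Suc k := smult_pm r b)) + \<theta> (c(Suc k := y))"
            using that Suc.prems(1) True y rb unfolding multilinear_on_def by blast
          also have "\<theta> (c(Suc k := smult_pm r b)) = sc r (\<theta> (c(Suc k := b)))"
            using that Suc.prems(1) True b unfolding multilinear_on_def by blast
          finally show ?thesis .
        qed
        show ?case using rby eq step by (simp only: lin[OF \<phi>] lin[OF \<psi>])
      qed
      moreover have "c (Suc k) \<in> pm.span (B (Suc k))"
        using Suc.prems(1) True by (auto simp: B_def free_on_span dest: PiE_mem)
      ultimately have "\<phi> (c(Suc k := c (Suc k))) = \<psi> (c(Suc k := c (Suc k)))" by blast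
      then show ?thesis by simp
    qed
  qed
  from this[of c n] assms(5) show ?thesis by simp
qed

theorem tensor_universal:
  fixes sc :: "'r::comm_ring_1 \<Rightarrow> 'm::ab_group_add \<Rightarrow> 'm"
    and \<phi> :: "(nat \<Rightarrow> ('b \<Rightarrow>\<^sub>0 'r)) \<Rightarrow> 'm"
  assumes "Modules.module sc" and \<phi>: "multilinear_on n (\<lambda>i. free_on (S i)) sc \<phi>"
  obtains \<Phi> where "module_hom smult_pm sc \<Phi>"
    and "\<And>c. c \<in> (\<Pi>\<^sub>E i\<in>{1..n}. free_on (S i)) \<Longrightarrow> \<Phi> (tensor n c) = \<phi> c"
    and "\<And>\<Psi> t. \<lbrakk>module_hom smult_pm sc \<Psi>;
           \<And>c. c \<in> (\<Pi>\<^sub>E i\<in>{1..n}. free_on (S i)) \<Longrightarrow> \<Psi> (tensor n c) = \<phi> c;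
           t \<in> free_on (Pi\<^sub>E {1..n} S)\<rbrakk> \<Longrightarrow> \<Psi> t = \<Phi> t"
proof
  interpret Modules.module sc by fact
  let ?s = "\<lambda>\<tau>. \<lambda>i\<in>{1..n}. Poly_Mapping.single (\<tau> i) (1::'r)"
  define \<Phi> where "\<Phi> t = (\<Sum>\<tau>\<in>Poly_Mapping.keys t. sc (Poly_Mapping.lookup t \<tau>) (\<phi> (?s \<tau>)))" for t
  have \<Phi>_eq: "\<Phi> t = (\<Sum>\<tau>\<in>K. sc (Poly_Mapping.lookup t \<tau>) (\<phi> (?s \<tau>)))" if "finite K" "Poly_Mapping.keys t \<subseteq> K" for t K
    unfolding \<Phi>_def using that by (intro sum.mono_neutral_left) (auto simp: in_keys_iff)
  show hom: "module_hom smult_pm sc \<Phi>"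
  proof
    fix x y :: "(nat \<Rightarrow> 'b) \<Rightarrow>\<^sub>0 'r"
    show "\<Phi> (x + y) = \<Phi> x + \<Phi> y"
      using Poly_Mapping.keys_add[of x y]
      by (simp add: \<Phi>_eq[of "Poly_Mapping.keys x \<union> Poly_Mapping.keys y"] lookup_add scale_left_distrib sum.distrib)
  next
    fix r and x :: "(nat \<Rightarrow> 'b) \<Rightarrow>\<^sub>0 'r"
    have "Poly_Mapping.keys (smult_pm r x) \<subseteq> Poly_Mapping.keys x" by (auto simp: in_keys_iff)
    then show "\<Phi> (smult_pm r x) = sc r (\<Phi> x)"
      by (simp add: \<Phi>_eq[of "Poly_Mapping.keys x"] scale_sum_right)
  qed
  then interpret \<Phi>: module_hom smult_pm sc \<Phi> .
  have \<Phi>_single: "\<Phi> (Poly_Mapping.single \<tau> 1) = \<phi> (?s \<tau>)" for \<tau>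
    by (simp add: \<Phi>_eq[of "{\<tau>}"])
  have s_cong: "?s (restrict \<tau> {1..n}) = ?s \<tau>" for \<tau> :: "nat \<Rightarrow> 'b" by auto
  have "multilinear_on n (\<lambda>i. free_on (S i)) sc (\<lambda>c. \<Phi> (tensor n c))"
    unfolding multilinear_on_def
  proof (intro ballI conjI allI)
    fix c :: "nat \<Rightarrow> ('b \<Rightarrow>\<^sub>0 'r)" and i and x y :: "'b \<Rightarrow>\<^sub>0 'r" and r :: 'r
    assume *: "c \<in> (\<Pi>\<^sub>E i\<in>{1..n}. free_on (S i))" "i \<in> {1..n}" "x \<in> free_on (S i)"
    show "\<Phi> (tensor n (c(i := smult_pm r x))) = sc r (\<Phi> (tensor n (c(i := x))))"
      using multilinear_on_tensor[of n "\<lambda>i. free_on (S i)"] *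
      unfolding multilinear_on_def \<Phi>.scale[symmetric] by (intro arg_cong[where f = \<Phi>]) blast
    assume "y \<in> free_on (S i)"
    then show "\<Phi> (tensor n (c(i := x + y))) = \<Phi> (tensor n (c(i := x))) + \<Phi> (tensor n (c(i := y)))"
      using multilinear_on_tensor[of n "\<lambda>i. free_on (S i)"] *
      unfolding multilinear_on_def \<Phi>.add[symmetric] by (intro arg_cong[where f = \<Phi>]) blast
  qed
  note eqI = multilinear_on_eqI[OF \<open>Modules.module sc\<close> this \<phi>]
  show \<Phi>_tensor: "\<Phi> (tensor n c) = \<phi> c" if "c \<in> (\<Pi>\<^sub>E i\<in>{1..n}. free_on (S i))" for c
    using _ that by (rule eqI) (simp only: tensor_single \<Phi>_single s_cong)
  fix \<Psi> :: "((nat \<Rightarrow> 'b) \<Rightarrow>\<^sub>0 'r) \<Rightarrow> 'm" and t :: "(nat \<Rightarrow> 'b) \<Rightarrow>\<^sub>0 'r"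
  assume \<Psi>: "module_hom smult_pm sc \<Psi>"
    and eq: "\<And>c. c \<in> (\<Pi>\<^sub>E i\<in>{1..n}. free_on (S i)) \<Longrightarrow> \<Psi> (tensor n c) = \<phi> c"
    and t: "t \<in> free_on (Pi\<^sub>E {1..n} S)"
  interpret \<Psi>: module_hom smult_pm sc \<Psi> by fact
  show "\<Psi> t = \<Phi> t"
    using t unfolding free_on_span
  proof (induction rule: pm.span_induct_alt)
    case base
    show ?case by (simp add: \<Phi>.zero \<Psi>.zero)
  next
    case (step r b y)
    then obtain \<tau> where \<tau>: "\<tau> \<in> Pi\<^sub>E {1..n} S" "b = Poly_Mapping.single \<tau> 1" by auto
    have s: "?s \<tau> \<in> (\<Pi>\<^sub>E i\<in>{1..n}. free_on (S i))"
      using \<tau>(1) by (auto simp: free_on_def)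
    have "b = tensor n (?s \<tau>)"
      using \<tau> by (simp only: tensor_single PiE_restrict)
    then have "\<Psi> b = \<Phi> b" using eq[OF s] \<Phi>_tensor[OF s] by simp
    with step show ?case by (simp add: \<Phi>.add \<Psi>.add \<Phi>.scale \<Psi>.scale)
  qed
qed


section \<open>Singular chains with coefficients in a ring\<close>

text \<open>The dimension is carried along explicitly, since a function
  \<^typ>\<open>(nat \<Rightarrow> real) \<Rightarrow> 'a\<close> can be a singular simplex in several dimensions.\<close>

type_synonym 'a gsimplex = "nat \<times> ((nat \<Rightarrow> real) \<Rightarrow> 'a)"

definition gsimplices :: "'a topology \<Rightarrow> 'a gsimplex set" where
  "gsimplices X = {(p, \<sigma>). singular_simplex p X \<sigma>}"

definition gsimplex_image :: "'a gsimplex \<Rightarrow> 'a set" where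
  "gsimplex_image s = snd s ` standard_simplex (fst s)"

definition gboundary :: "('a gsimplex \<Rightarrow>\<^sub>0 'r::comm_ring_1) \<Rightarrow> ('a gsimplex \<Rightarrow>\<^sub>0 'r)" where
  "gboundary = linear_extension
     (\<lambda>(p, \<sigma>). if p = 0 then 0
       else \<Sum>k\<le>p. smult_pm ((-1) ^ k) (Poly_Mapping.single (p - 1, singular_face p k \<sigma>) 1))"

definition gchain_map :: "('a \<Rightarrow> 'b) \<Rightarrow> ('a gsimplex \<Rightarrow>\<^sub>0 'r::comm_ring_1) \<Rightarrow> ('b gsimplex \<Rightarrow>\<^sub>0 'r)" where
  "gchain_map h = linear_extension (\<lambda>(p, \<sigma>). Poly_Mapping.single (p, simplex_map p h \<sigma>) 1)"


section \<open>The tensor product complex\<close>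

type_synonym ('a, 'r) tensor_chain = "(nat \<Rightarrow> 'a gsimplex) \<Rightarrow>\<^sub>0 'r"

definition simplex_tuples :: "nat \<Rightarrow> 'a topology \<Rightarrow> (nat \<Rightarrow> 'a set) \<Rightarrow> nat \<Rightarrow> (nat \<Rightarrow> 'a gsimplex) set" where
  "simplex_tuples n X A p =
     {\<tau> \<in> (\<Pi>\<^sub>E i\<in>{1..n}. gsimplices (subtopology X (A i))). (\<Sum>i\<in>{1..n}. fst (\<tau> i)) = p}"

definition simplex_tensor :: "nat \<Rightarrow> (nat \<Rightarrow> 'a gsimplex) \<Rightarrow> ('a, 'r::comm_ring_1) tensor_chain" where
  "simplex_tensor n \<tau> = tensor n (\<lambda>i. Poly_Mapping.single (\<tau> i) 1)"

definition tensor_group ::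
  "nat \<Rightarrow> 'a topology \<Rightarrow> (nat \<Rightarrow> 'a set) \<Rightarrow> nat \<Rightarrow> ('a, 'r::comm_ring_1) tensor_chain monoid"
where
  "tensor_group n X A p = \<lparr>carrier = free_on (simplex_tuples n X A p), mult = (+), one = 0\<rparr>"

definition tensor_boundary ::
  "nat \<Rightarrow> ('a, 'r::comm_ring_1) tensor_chain \<Rightarrow> ('a, 'r) tensor_chain"
where
  "tensor_boundary n = linear_extension
     (\<lambda>\<tau>. \<Sum>i\<in>{1..n}. smult_pm ((-1) ^ (\<Sum>j\<in>{1..<i}. fst (\<tau> j)))
        (tensor n ((\<lambda>j. Poly_Mapping.single (\<tau> j) 1)(i := gboundary (Poly_Mapping.single (\<tau> i) 1)))))"

definition tensor_chain_map ::
  "nat \<Rightarrow> (nat \<Rightarrow> 'a \<Rightarrow> 'b) \<Rightarrow> ('a, 'r::comm_ring_1) tensor_chain \<Rightarrow> ('b, 'r) tensor_chain"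
where
  "tensor_chain_map n f = linear_extension
     (\<lambda>\<tau>. tensor n (\<lambda>i. gchain_map (f i) (Poly_Mapping.single (\<tau> i) 1)))"

definition noninteracting ::
  "nat \<Rightarrow> 'a topology \<Rightarrow> (nat \<Rightarrow> 'a set) \<Rightarrow> nat \<Rightarrow> ('a, 'r::comm_ring_1) tensor_chain set"
where
  "noninteracting n X A p = pm.span
     {simplex_tensor n \<tau> |\<tau>. \<tau> \<in> simplex_tuples n X A p \<and> (\<Inter>i\<in>{1..n}. gsimplex_image (\<tau> i)) = {}}"


section \<open>Interaction singular homology\<close>

text \<open>All subsets factored out below are \<open>R\<close>-submodules; the quotients are formed on the underlying
  additive groups, which have the same cosets as the quotient \<open>R\<close>-modules.\<close>

text \<open>The map into \<open>G Mod K\<close> that \<^term>\<open>h\<close> induces on cosets; it sends the coset of \<open>x\<close> to the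
  coset of \<open>h x\<close> whenever that does not depend on the choice of \<open>x\<close>.\<close>

definition coset_map :: "('d, 'e) monoid_scheme \<Rightarrow> 'd set \<Rightarrow> ('c \<Rightarrow> 'd) \<Rightarrow> 'c set \<Rightarrow> 'd set" where
  "coset_map G K h Q = the_elem ((\<lambda>x. K #>\<^bsub>G\<^esub> h x) ` Q)"

definition IS ::
  "nat \<Rightarrow> 'a topology \<Rightarrow> (nat \<Rightarrow> 'a set) \<Rightarrow> nat \<Rightarrow> ('a, 'r::comm_ring_1) tensor_chain set monoid"
where
  "IS n X A p = tensor_group n X A p Mod noninteracting n X A p"

definition IS_boundary ::
  "nat \<Rightarrow> 'a topology \<Rightarrow> (nat \<Rightarrow> 'a set) \<Rightarrow> nat \<Rightarrow>
   ('a, 'r::comm_ring_1) tensor_chain set \<Rightarrow> ('a, 'r) tensor_chain set"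
where
  "IS_boundary n X A p =
     coset_map (tensor_group n X A (p - 1)) (noninteracting n X A (p - 1)) (tensor_boundary n)"

definition IS_map ::
  "nat \<Rightarrow> 'b topology \<Rightarrow> (nat \<Rightarrow> 'b set) \<Rightarrow> (nat \<Rightarrow> 'a \<Rightarrow> 'b) \<Rightarrow> nat \<Rightarrow>
   ('a, 'r::comm_ring_1) tensor_chain set \<Rightarrow> ('b, 'r) tensor_chain set"
where
  "IS_map n Y B f p =
     coset_map (tensor_group n Y B p) (noninteracting n Y B p) (tensor_chain_map n f)"

definition IS_cycles ::
  "nat \<Rightarrow> 'a topology \<Rightarrow> (nat \<Rightarrow> 'a set) \<Rightarrow> nat \<Rightarrow> ('a, 'r::comm_ring_1) tensor_chain set monoid"
where
  "IS_cycles n X A p = (IS n X A p)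
     \<lparr>carrier := if p = 0 then carrier (IS n X A 0)
                 else kernel (IS n X A p) (IS n X A (p - 1)) (IS_boundary n X A p)\<rparr>"

definition IS_boundaries ::
  "nat \<Rightarrow> 'a topology \<Rightarrow> (nat \<Rightarrow> 'a set) \<Rightarrow> nat \<Rightarrow> ('a, 'r::comm_ring_1) tensor_chain set set"
where
  "IS_boundaries n X A p = IS_boundary n X A (Suc p) ` carrier (IS n X A (Suc p))"

definition interaction_homology ::
  "nat \<Rightarrow> 'a topology \<Rightarrow> (nat \<Rightarrow> 'a set) \<Rightarrow> nat \<Rightarrow> ('a, 'r::comm_ring_1) tensor_chain set set monoid"
where
  "interaction_homology n X A p = IS_cycles n X A p Mod IS_boundaries n X A p"

definition interaction_homology_map ::
  "nat \<Rightarrow> 'b topology \<Rightarrow> (nat \<Rightarrow> 'b set) \<Rightarrow> (nat \<Rightarrow> 'a \<Rightarrow> 'b) \<Rightarrow> nat \<Rightarrow>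
   ('a, 'r::comm_ring_1) tensor_chain set set \<Rightarrow> ('b, 'r) tensor_chain set set"
where
  "interaction_homology_map n Y B f p =
     coset_map (IS_cycles n Y B p) (IS_boundaries n Y B p) (IS_map n Y B f p)"

end

theory Submission
  imports Defs
begin

text \<open>A formal homotopy \<open>H\<close> gives, in each factor, the prism operator \<open>P\<^sub>i\<close> with
  \<open>d P\<^sub>i + P\<^sub>i d = F\<^sub>i - G\<^sub>i\<close>, where \<open>F\<^sub>i\<close> and \<open>G\<^sub>i\<close> are induced by the two ends of \<open>H\<^sub>i\<close>. With
  \<open>\<epsilon> \<sigma> = (-1)\<^bsup>dim \<sigma>\<^esup> \<sigma>\<close>, the operator
  \<open>D = \<Sum>\<^sub>k \<epsilon>F\<^sub>1 \<otimes> \<dots> \<otimes> \<epsilon>F\<^bsub>k-1\<^esub> \<otimes> P\<^sub>k \<otimes> G\<^bsub>k+1\<^esub> \<otimes> \<dots> \<otimes> G\<^sub>n\<close> on the tensor product satisfies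
  \<open>d D + D d = F\<^sub>1 \<otimes> \<dots> \<otimes> F\<^sub>n - G\<^sub>1 \<otimes> \<dots> \<otimes> G\<^sub>n\<close>. Every simplex occurring in the \<open>i\<close>-th factor of
  \<open>D(\<sigma>\<^sub>1 \<otimes> \<dots> \<otimes> \<sigma>\<^sub>n)\<close> has its image in \<open>H\<^sub>i(im \<sigma>\<^sub>i \<times> I)\<close>; since \<open>H\<close> is a morphism of interaction
  spaces, a point common to all these sets comes from a point common to all \<open>im \<sigma>\<^sub>i\<close>. Hence \<open>D\<close>
  preserves the subcomplex \<open>T\<close> and descends to a chain homotopy between the interaction complexes.\<close>

section \<open>Linear maps of free modules and their tensor products\<close>

abbreviation linear_map :: "(('b \<Rightarrow>\<^sub>0 'r::comm_ring_1) \<Rightarrow> ('c \<Rightarrow>\<^sub>0 'r)) \<Rightarrow> bool" where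
  "linear_map \<equiv> module_hom smult_pm smult_pm"

abbreviation gen :: "'b \<Rightarrow> ('b \<Rightarrow>\<^sub>0 'r::comm_ring_1)" where
  "gen b \<equiv> Poly_Mapping.single b 1"

lemma linear_mapI:
  fixes F :: "('b \<Rightarrow>\<^sub>0 'r::comm_ring_1) \<Rightarrow> ('c \<Rightarrow>\<^sub>0 'r)"
  assumes "\<And>x y. F (x + y) = F x + F y" "\<And>r x. F (smult_pm r x) = smult_pm r (F x)"
  shows "linear_map F"
  by standard (use assms in auto)

lemma linear_map_simps:
  assumes "linear_map F"
  shows "F (x + y) = F x + F y" "F (smult_pm r x) = smult_pm r (F x)" "F 0 = 0"
    "F (- x) = - F x" "F (x - y) = F x - F y" "F (sum h I) = (\<Sum>i\<in>I. F (h i))"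
proof -
  interpret module_hom smult_pm smult_pm F by fact
  show "F (x + y) = F x + F y" "F (smult_pm r x) = smult_pm r (F x)" "F 0 = 0"
    "F (- x) = - F x" "F (x - y) = F x - F y" "F (sum h I) = (\<Sum>i\<in>I. F (h i))"
    by (rule add scale zero neg diff sum)+
qed

lemma linear_map_id: "linear_map (\<lambda>x. x)"
  by (rule linear_mapI) auto

lemma linear_map_comp:
  assumes "linear_map F" "linear_map G"
  shows "linear_map (\<lambda>x. F (G x))"
  by (rule linear_mapI) (simp_all add: linear_map_simps[OF assms(1)] linear_map_simps[OF assms(2)])

lemma linear_map_add:
  assumes "linear_map F" "linear_map G"
  shows "linear_map (\<lambda>x. F x + G x)"
  by (rule linear_mapI)
    (simp_all add: linear_map_simps[OF assms(1)] linear_map_simps[OF assms(2)] pm.scale_right_distrib)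

lemma linear_map_diff:
  assumes "linear_map F" "linear_map G"
  shows "linear_map (\<lambda>x. F x - G x)"
  by (rule linear_mapI)
    (simp_all add: linear_map_simps[OF assms(1)] linear_map_simps[OF assms(2)] pm.scale_right_diff_distrib)

lemma linear_map_sum:
  assumes "\<And>i. i \<in> I \<Longrightarrow> linear_map (F i)"
  shows "linear_map (\<lambda>x. \<Sum>i\<in>I. F i x)"
  by (rule linear_mapI)
    (simp_all add: linear_map_simps[OF assms] pm.scale_sum_right sum.distrib)

lemma linear_map_linear_extension [simp]: "linear_map (linear_extension \<phi>)"
proof -
  \<comment> \<open>Keys outside the support contribute 0, so the sum may run over any finite
    superset. This matters because \<open>x + y\<close> can have fewer keys than \<open>x\<close>
    and \<open>y\<close> together.\<close>
  have eq: "linear_extension \<phi> c = (\<Sum>b\<in>K. smult_pm (Poly_Mapping.lookup c b) (\<phi> b))"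
    if "finite K" "Poly_Mapping.keys c \<subseteq> K" for c K
    unfolding linear_extension_def using that
    by (intro sum.mono_neutral_left) (auto simp: in_keys_iff)
  show ?thesis
  proof (rule linear_mapI)
    fix x y r
    show "linear_extension \<phi> (x + y) = linear_extension \<phi> x + linear_extension \<phi> y"
      using Poly_Mapping.keys_add[of x y]
      by (simp add: eq[of "Poly_Mapping.keys x \<union> Poly_Mapping.keys y"] lookup_add
          pm.scale_left_distrib sum.distrib)
    have "Poly_Mapping.keys (smult_pm r x) \<subseteq> Poly_Mapping.keys x"
      by (auto simp: in_keys_iff)
    then show "linear_extension \<phi> (smult_pm r x) = smult_pm r (linear_extension \<phi> x)"
      by (simp add: eq[of "Poly_Mapping.keys x"] pm.scale_sum_right)
  qed
qed

lemma linear_extension_gen [simp]: "linear_extension \<phi> (gen b) = \<phi> b"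
  by (simp add: linear_extension_def)

lemma free_on_induct [consumes 1, case_names zero add]:
  assumes "c \<in> free_on S" "P 0"
    "\<And>r b y. b \<in> S \<Longrightarrow> P y \<Longrightarrow> P (smult_pm r (gen b) + y)"
  shows "P (c :: 'b \<Rightarrow>\<^sub>0 'r::comm_ring_1)"
  using assms(1) unfolding free_on_span
  by (induction rule: pm.span_induct_alt) (use assms in auto)

text \<open>With \<open>S = UNIV\<close> every chain is a linear combination of generators, so the
  operator identities below reduce to single generators.\<close>

lemma linear_map_eqI:
  assumes F: "linear_map F" and G: "linear_map G" and "\<And>b. F (gen b) = G (gen b)"
  shows "F c = G c"
proof -
  have "c \<in> free_on UNIV" by (simp add: free_on_def)
  then show ?thesis
    by (induction rule: free_on_induct)
      (simp_all add: linear_map_simps[OF F] linear_map_simps[OF G] assms(3))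
qed

lemma free_on_subspace: "pm.subspace (free_on S)"
  unfolding free_on_span by (rule pm.subspace_span)

lemma free_on_closed:
  "0 \<in> free_on S" "x \<in> free_on S \<Longrightarrow> y \<in> free_on S \<Longrightarrow> x + y \<in> free_on S"
  "x \<in> free_on S \<Longrightarrow> y \<in> free_on S \<Longrightarrow> x - y \<in> free_on S"
  "x \<in> free_on S \<Longrightarrow> - x \<in> free_on S"
  "x \<in> free_on S \<Longrightarrow> smult_pm r x \<in> free_on S"
  "(\<And>i. i \<in> I \<Longrightarrow> h i \<in> free_on S) \<Longrightarrow> sum h I \<in> free_on S"
  by (simp_all add: pm.subspace_0[OF free_on_subspace] pm.subspace_add[OF free_on_subspace]
      pm.subspace_diff[OF free_on_subspace] pm.subspace_neg[OF free_on_subspace]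
      pm.subspace_scale[OF free_on_subspace] pm.subspace_sum[OF free_on_subspace])

lemma free_on_gen [simp]: "b \<in> S \<Longrightarrow> gen b \<in> free_on S"
  by (simp add: free_on_def)

lemma free_on_mono: "S \<subseteq> S' \<Longrightarrow> free_on S \<subseteq> free_on S'"
  by (auto simp: free_on_def)

lemma linear_map_free_on:
  assumes F: "linear_map F" and "\<And>b. b \<in> S \<Longrightarrow> F (gen b) \<in> free_on S'" and "c \<in> free_on S"
  shows "F c \<in> free_on S'"
  using assms(3)
  by (induction rule: free_on_induct)
    (simp_all add: linear_map_simps[OF F] assms(2) free_on_closed)

section \<open>Multilinearity of the tensor\<close>

lemma tensor_cong:
  assumes "\<And>i. i \<in> {1..n} \<Longrightarrow> c i = c' i"
  shows "tensor n c = tensor n c'"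
  by (rule poly_mapping_eqI) (use assms in \<open>auto simp: lookup_tensor intro!: prod.cong\<close>)

text \<open>\<open>multilinear_on\<close> concerns extensional tuples; \<open>tensor\<close> ignores
  arguments outside \<open>{1..n}\<close>, so \<open>c\<close> may be replaced by its
  restriction.\<close>

lemma tensor_upd_add:
  fixes c :: "nat \<Rightarrow> ('b \<Rightarrow>\<^sub>0 'r::comm_ring_1)"
  assumes "i \<in> {1..n}"
  shows "tensor n (c(i := x + y)) = tensor n (c(i := x)) + tensor n (c(i := y))"
proof -
  let ?c = "restrict c {1..n}"
  have "tensor n (c(i := z)) = tensor n (?c(i := z))" for z
    using assms by (intro tensor_cong) auto
  moreover have "multilinear_on n (\<lambda>i. UNIV) smult_pm (tensor n :: (nat \<Rightarrow> ('b \<Rightarrow>\<^sub>0 'r)) \<Rightarrow> _)"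
    by (rule multilinear_on_tensor)
  moreover have "?c \<in> {1..n} \<rightarrow>\<^sub>E UNIV" by simp
  ultimately show ?thesis
    using assms unfolding multilinear_on_def by (metis UNIV_I)
qed

lemma tensor_upd_smult:
  fixes c :: "nat \<Rightarrow> ('b \<Rightarrow>\<^sub>0 'r::comm_ring_1)"
  assumes "i \<in> {1..n}"
  shows "tensor n (c(i := smult_pm r x)) = smult_pm r (tensor n (c(i := x)))"
proof -
  let ?c = "restrict c {1..n}"
  have "tensor n (c(i := z)) = tensor n (?c(i := z))" for z
    using assms by (intro tensor_cong) auto
  moreover have "multilinear_on n (\<lambda>i. UNIV) smult_pm (tensor n :: (nat \<Rightarrow> ('b \<Rightarrow>\<^sub>0 'r)) \<Rightarrow> _)"
    by (rule multilinear_on_tensor)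
  moreover have "?c \<in> {1..n} \<rightarrow>\<^sub>E UNIV" by simp
  ultimately show ?thesis
    using assms unfolding multilinear_on_def by (metis UNIV_I)
qed

text \<open>Later gathers the signs of the individual factors into one Koszul sign.\<close>

lemma tensor_smult:
  "tensor n (\<lambda>i. smult_pm (r i) (c i)) = smult_pm (\<Prod>i\<in>{1..n}. r i) (tensor n c)"
  by (rule poly_mapping_eqI) (simp add: lookup_tensor prod.distrib)

lemma tensor_gen: "tensor n (\<lambda>i. gen (\<tau> i)) = gen (restrict \<tau> {1..n})"
  unfolding tensor_single[symmetric] by (rule tensor_cong) simp

text \<open>This is \<open>\<phi>\<^sub>1 \<otimes> \<dots> \<otimes> \<phi>\<^sub>n\<close>.
  Prescribing it on generators makes it linear for arbitrary \<open>\<phi>\<close>; it depends only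
  on the values \<open>\<phi> i (gen b)\<close>.\<close>

definition tensor_map ::
  "nat \<Rightarrow> (nat \<Rightarrow> ('b \<Rightarrow>\<^sub>0 'r::comm_ring_1) \<Rightarrow> ('c \<Rightarrow>\<^sub>0 'r)) \<Rightarrow> ((nat \<Rightarrow> 'b) \<Rightarrow>\<^sub>0 'r) \<Rightarrow> ((nat \<Rightarrow> 'c) \<Rightarrow>\<^sub>0 'r)"
where
  "tensor_map n \<phi> = linear_extension (\<lambda>\<tau>. tensor n (\<lambda>i. \<phi> i (gen (\<tau> i))))"

lemma linear_map_tensor_map [simp]: "linear_map (tensor_map n \<phi>)"
  by (simp add: tensor_map_def)

lemma tensor_map_gen: "tensor_map n \<phi> (gen \<tau>) = tensor n (\<lambda>i. \<phi> i (gen (\<tau> i)))"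
  by (simp add: tensor_map_def)

lemma tensor_map_cong:
  assumes "\<And>i x. i \<in> {1..n} \<Longrightarrow> \<phi> i (gen x) = \<psi> i (gen x)"
  shows "tensor_map n \<phi> c = tensor_map n \<psi> c"
  by (rule linear_map_eqI) (auto simp: tensor_map_gen assms intro!: tensor_cong)

text \<open>Both sides are multilinear in \<open>c\<close>, hence determined by tuples of
  generators, where they agree by definition. Extensionality again forces the passage through
  \<open>?c\<close>.\<close>

lemma tensor_map_tensor:
  fixes c :: "nat \<Rightarrow> 'b \<Rightarrow>\<^sub>0 'r::comm_ring_1" and \<phi> :: "nat \<Rightarrow> ('b \<Rightarrow>\<^sub>0 'r) \<Rightarrow> ('c \<Rightarrow>\<^sub>0 'r)"
  assumes \<phi>: "\<And>i. i \<in> {1..n} \<Longrightarrow> linear_map (\<phi> i)"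
  shows "tensor_map n \<phi> (tensor n c) = tensor n (\<lambda>i. \<phi> i (c i))"
proof -
  let ?c = "restrict c {1..n}"
  have upd: "(\<lambda>j. \<phi> j ((c(i := x)) j)) = (\<lambda>j. \<phi> j (c j))(i := \<phi> i x)" for c i x
    by auto
  have "tensor_map n \<phi> (tensor n ?c) = tensor n (\<lambda>i. \<phi> i (?c i))"
  proof (rule multilinear_on_eqI[where S = "\<lambda>i. UNIV" and sc = smult_pm and c = ?c
        and \<phi> = "\<lambda>c. tensor_map n \<phi> (tensor n c)" and \<psi> = "\<lambda>c. tensor n (\<lambda>i. \<phi> i (c i))"])
    show "Modules.module (smult_pm :: 'r \<Rightarrow> ((nat \<Rightarrow> 'c) \<Rightarrow>\<^sub>0 'r) \<Rightarrow> _)"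
      by (rule pm.module_axioms)
    show "multilinear_on n (\<lambda>i. free_on UNIV) smult_pm (\<lambda>c. tensor_map n \<phi> (tensor n c))"
      unfolding multilinear_on_def
      by (auto simp: tensor_upd_add tensor_upd_smult linear_map_simps[OF linear_map_tensor_map])
    show "multilinear_on n (\<lambda>i. free_on UNIV) smult_pm (\<lambda>c. tensor n (\<lambda>i. \<phi> i (c i)))"
      unfolding multilinear_on_def upd
      by (auto simp: linear_map_simps[OF \<phi>] tensor_upd_add tensor_upd_smult)
    show "?c \<in> (\<Pi>\<^sub>E i\<in>{1..n}. free_on UNIV)"
      by (auto simp: free_on_def)
    fix \<tau> :: "nat \<Rightarrow> 'b"
    show "tensor_map n \<phi> (tensor n (\<lambda>i\<in>{1..n}. gen (\<tau> i))) =
        tensor n (\<lambda>i. \<phi> i ((\<lambda>i\<in>{1..n}. gen (\<tau> i)) i))"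
      unfolding tensor_single tensor_map_gen by (rule tensor_cong) auto
  qed
  moreover have "tensor n ?c = tensor n c" "tensor n (\<lambda>i. \<phi> i (?c i)) = tensor n (\<lambda>i. \<phi> i (c i))"
    by (auto intro!: tensor_cong)
  ultimately show ?thesis by simp
qed

text \<open>The inner maps are evaluated on generators, but the outer ones on the chains
  \<open>\<psi> i (gen b)\<close>; this is where linearity of \<open>\<phi>\<close> enters.\<close>

lemma tensor_map_comp:
  assumes "\<And>i. i \<in> {1..n} \<Longrightarrow> linear_map (\<phi> i)"
  shows "tensor_map n \<phi> (tensor_map n \<psi> c) = tensor_map n (\<lambda>i x. \<phi> i (\<psi> i x)) c"
  by (rule linear_map_eqI[OF linear_map_comp[OF linear_map_tensor_map linear_map_tensor_map] linear_map_tensor_map])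
    (simp only: tensor_map_gen, rule tensor_map_tensor[OF assms])

lemma tensor_map_add:
  assumes k: "k \<in> {1..n}"
    and "\<And>x. \<theta> k (gen x) = \<phi> k (gen x) + \<psi> k (gen x)"
    and "\<And>i x. i \<in> {1..n} \<Longrightarrow> i \<noteq> k \<Longrightarrow> \<phi> i (gen x) = \<theta> i (gen x) \<and> \<psi> i (gen x) = \<theta> i (gen x)"
  shows "tensor_map n \<phi> c + tensor_map n \<psi> c = tensor_map n \<theta> c"
proof (rule linear_map_eqI[where F = "\<lambda>c. tensor_map n \<phi> c + tensor_map n \<psi> c"])
  fix \<tau>
  let ?c = "\<lambda>i. \<theta> i (gen (\<tau> i))"
  have "tensor n ?c = tensor n (?c(k := \<phi> k (gen (\<tau> k)) + \<psi> k (gen (\<tau> k))))"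
    by (rule tensor_cong) (auto simp: assms(2))
  also have "\<dots> = tensor n (?c(k := \<phi> k (gen (\<tau> k)))) + tensor n (?c(k := \<psi> k (gen (\<tau> k))))"
    by (rule tensor_upd_add[OF k])
  also have "\<dots> = tensor n (\<lambda>i. \<phi> i (gen (\<tau> i))) + tensor n (\<lambda>i. \<psi> i (gen (\<tau> i)))"
    by (intro arg_cong2[where f = "(+)"] tensor_cong) (auto simp: assms(3))
  finally show "tensor_map n \<phi> (gen \<tau>) + tensor_map n \<psi> (gen \<tau>) = tensor_map n \<theta> (gen \<tau>)"
    by (simp add: tensor_map_gen)
qed (rule linear_map_add[OF linear_map_tensor_map linear_map_tensor_map] linear_map_tensor_map)+

lemma tensor_zero:
  assumes "k \<in> {1..n}" "c k = 0"
  shows "tensor n c = 0"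
  by (rule poly_mapping_eqI) (use assms in \<open>auto simp: lookup_tensor intro!: prod_zero bexI[of _ k]\<close>)

text \<open>By additivity in factor \<open>k\<close> the sum is a tensor map with a zero factor.
  This turns a sign in a single factor into anticommutation on the tensor product.\<close>

lemma tensor_map_cancel:
  assumes "k \<in> {1..n}"
    and "\<And>x. \<phi> k (gen x) + \<psi> k (gen x) = 0"
    and "\<And>i x. i \<in> {1..n} \<Longrightarrow> i \<noteq> k \<Longrightarrow> \<phi> i (gen x) = \<psi> i (gen x)"
  shows "tensor_map n \<phi> c + tensor_map n \<psi> c = 0"
proof -
  have "tensor_map n \<phi> c + tensor_map n \<psi> c = tensor_map n (\<phi>(k := \<lambda>x. 0)) c"
    by (rule tensor_map_add[where k = k]) (use assms in auto)
  also have "\<dots> = 0"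
    by (rule linear_map_eqI[where G = "\<lambda>_. 0"])
      (auto simp: tensor_map_gen intro!: tensor_zero[of k] assms(1) linear_mapI)
  finally show ?thesis .
qed

text \<open>Template for the support estimates: simplices confined to \<open>U i (\<tau> i)\<close>
  in each factor give tuples confined to the product of these sets.\<close>

lemma tensor_map_free_on:
  assumes "c \<in> free_on S"
    and "\<And>\<tau> i. \<tau> \<in> S \<Longrightarrow> i \<in> {1..n} \<Longrightarrow> \<phi> i (gen (\<tau> i)) \<in> free_on (U i (\<tau> i))"
    and "\<And>\<tau>. \<tau> \<in> S \<Longrightarrow> (\<Pi>\<^sub>E i\<in>{1..n}. U i (\<tau> i)) \<subseteq> S'"
  shows "tensor_map n \<phi> c \<in> free_on S'"
proof (rule linear_map_free_on[OF _ _ assms(1)])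
  fix \<tau> assume \<tau>: "\<tau> \<in> S"
  show "tensor_map n \<phi> (gen \<tau>) \<in> free_on S'"
    unfolding tensor_map_gen
    by (rule subsetD[OF free_on_mono[OF assms(3)[OF \<tau>]]])
      (rule tensor_in_free_on, rule assms(2)[OF \<tau>])
qed simp

section \<open>The prism operator\<close>

lemma gboundary_gen:
  "gboundary (gen (p, \<sigma>)) = (if p = 0 then 0
     else \<Sum>k\<le>p. smult_pm ((-1) ^ k) (gen (p - 1, singular_face p k \<sigma>)))"
  by (simp add: gboundary_def)

lemma gboundary_gen_Suc:
  "gboundary (gen (Suc p, \<sigma>)) = (\<Sum>k\<le>Suc p. smult_pm ((-1) ^ k) (gen (p, singular_face (Suc p) k \<sigma>)))"
  by (simp add: gboundary_gen)

lemma linear_map_gboundary [simp]: "linear_map gboundary"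
  by (simp add: gboundary_def)

lemma gchain_map_gen: "gchain_map h (gen (p, \<sigma>)) = gen (p, simplex_map p h \<sigma>)"
  by (simp add: gchain_map_def)

lemma linear_map_gchain_map [simp]: "linear_map (gchain_map h)"
  by (simp add: gchain_map_def)

lemmas gboundary_simps = linear_map_simps[OF linear_map_gboundary]
lemmas gchain_map_simps = linear_map_simps[OF linear_map_gchain_map]

text \<open>Both sides are restricted functions; they agree because the face inclusion maps
  \<open>standard_simplex (p - 1)\<close> into \<open>standard_simplex p\<close>.\<close>

lemma simplex_map_singular_face:
  assumes "1 \<le> p" "k \<le> p"
  shows "singular_face p k (simplex_map p h \<sigma>) = simplex_map (p - 1) h (singular_face p k \<sigma>)"
  using assms simplical_face_in_standard_simplex[of p k]
  by (auto simp: singular_face_def simplex_map_def fun_eq_iff restrict_def)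

lemma gboundary_gchain_map:
  fixes h :: "'a \<Rightarrow> 'b" and c :: "'a gsimplex \<Rightarrow>\<^sub>0 'r::comm_ring_1"
  shows "gboundary (gchain_map h c) = gchain_map h (gboundary c)"
proof (rule linear_map_eqI[where F = "\<lambda>c. gboundary (gchain_map h c)" and G = "\<lambda>c. gchain_map h (gboundary c)"])
  fix b :: "'a gsimplex"
  obtain p \<sigma> where b: "b = (p, \<sigma>)" by (cases b)
  show "gboundary (gchain_map h (gen b)) = gchain_map h (gboundary (gen b :: _ \<Rightarrow>\<^sub>0 'r))"
    unfolding b
    by (auto simp: gboundary_gen gchain_map_simps gchain_map_gen simplex_map_singular_face intro!: sum.cong)
qed (rule linear_map_comp[OF linear_map_gboundary linear_map_gchain_map]
    linear_map_comp[OF linear_map_gchain_map linear_map_gboundary])+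

section \<open>Degeneracies of the standard simplex in barycentric coordinates\<close>

definition degeneracy :: "nat \<Rightarrow> (nat \<Rightarrow> real) \<Rightarrow> nat \<Rightarrow> real" where
  "degeneracy i x = (\<lambda>k. if k < i then x k else if k = i then x i + x (Suc i) else x (Suc k))"

text \<open>Governs the time coordinate of a prism simplex on a face: the inserted zero uses up one
  summand exactly when it stands among the first \<open>Suc m\<close> places.\<close>

lemma sum_simplical_face:
  "(\<Sum>l<Suc m. simplical_face j x l) = (if j \<le> m then \<Sum>l<m. x l else \<Sum>l<Suc m. x l :: real)"
proof (induction m)
  case (Suc m)
  then show ?case by (auto simp: simplical_face_def not_le less_Suc_eq le_Suc_eq)
qed (auto simp: simplical_face_def)

text \<open>This and the next two are the cosimplicial identities for codegeneracies and cofaces.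
  They separate the faces of a prism simplex over the boundary of the base from the faces
  \<open>prism_middle\<close>.\<close>

lemma degeneracy_face_less:
  "j \<le> i \<Longrightarrow> degeneracy (Suc i) (simplical_face j x) = simplical_face j (degeneracy i x)"
  by (rule ext) (auto simp: degeneracy_def simplical_face_def)

lemma degeneracy_face_eq: "j = i \<or> j = Suc i \<Longrightarrow> degeneracy i (simplical_face j x) = x"
  by (rule ext) (auto simp: degeneracy_def simplical_face_def)

lemma degeneracy_face_greater:
  "i < j \<Longrightarrow> degeneracy i (simplical_face (Suc j) x) = simplical_face j (degeneracy i x)"
  by (rule ext) (auto simp: degeneracy_def simplical_face_def)

lemma sum_degeneracy:
  assumes "i \<le> p"
  shows "(\<Sum>k\<le>p. degeneracy i x k) = (\<Sum>k\<le>Suc p. x k)"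
  using assms
proof (induction p)
  case (Suc p)
  then show ?case
  proof (cases "i = Suc p")
    case True
    have "(\<Sum>k\<le>p. degeneracy i x k) = (\<Sum>k\<le>p. x k)"
      using True by (intro sum.cong) (auto simp: degeneracy_def)
    then show ?thesis using True by (simp add: degeneracy_def)
  qed (simp add: degeneracy_def)
qed (simp add: degeneracy_def)

lemma sum_standard_simplex_le_1:
  assumes "x \<in> standard_simplex p" "finite K"
  shows "sum x K \<le> 1"
proof -
  have "sum x K = sum x (K \<inter> {..p})"
    using assms by (intro sum.mono_neutral_right) (auto simp: standard_simplex_def not_le)
  also have "\<dots> \<le> sum x {..p}"
    using assms by (intro sum_mono2) (auto simp: standard_simplex_def)
  finally show ?thesis using assms by (simp add: standard_simplex_def)
qed

lemma degeneracy_in_standard_simplex: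
  assumes "i \<le> p" "x \<in> standard_simplex (Suc p)"
  shows "degeneracy i x \<in> standard_simplex p"
proof -
  \<comment> \<open>The merged coordinate is a partial sum of barycentric coordinates.\<close>
  have "x i + x (Suc i) \<le> 1"
    using sum_standard_simplex_le_1[OF assms(2), of "{i, Suc i}"] by simp
  then show ?thesis
    using assms sum_degeneracy[OF assms(1), of x]
    by (auto simp: standard_simplex_def) (auto simp: degeneracy_def)
qed

text \<open>Pulling \<open>\<sigma>\<close> back along the \<open>i\<close>-th degeneracy and using \<open>x\<^sub>0 + \<dots> + x\<^sub>i\<close> as the time coordinate
  parametrises the \<open>i\<close>-th simplex of the standard triangulation of the prism \<open>\<Delta>\<^sup>p \<times> I\<close>.\<close>

definition prism_simplex :: "('a \<times> real \<Rightarrow> 'b) \<Rightarrow> nat \<Rightarrow> nat \<Rightarrow> ((nat \<Rightarrow> real) \<Rightarrow> 'a) \<Rightarrow> (nat \<Rightarrow> real) \<Rightarrow> 'b" where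
  "prism_simplex H p i \<sigma> =
     restrict (\<lambda>x. H (\<sigma> (degeneracy i x), \<Sum>l<Suc i. x l)) (standard_simplex (Suc p))"

definition prism :: "('a \<times> real \<Rightarrow> 'b) \<Rightarrow> ('a gsimplex \<Rightarrow>\<^sub>0 'r::comm_ring_1) \<Rightarrow> ('b gsimplex \<Rightarrow>\<^sub>0 'r)" where
  "prism H = linear_extension
     (\<lambda>(p, \<sigma>). \<Sum>i\<le>p. smult_pm ((-1) ^ i) (gen (Suc p, prism_simplex H p i \<sigma>)))"

lemma prism_gen:
  "prism H (gen (p, \<sigma>)) = (\<Sum>i\<le>p. smult_pm ((-1) ^ i) (gen (Suc p, prism_simplex H p i \<sigma>)))"
  by (simp add: prism_def)

lemma linear_map_prism [simp]: "linear_map (prism H)"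
  by (simp add: prism_def)

text \<open>The zero inserted at \<open>j\<close> falls within the time sum, which loses a term;
  this matches the index drop from \<open>Suc i\<close> to \<open>i\<close>.\<close>

lemma face_prism_simplex_less:
  assumes "j \<le> i" "i < p"
  shows "singular_face (Suc p) j (prism_simplex H p (Suc i) \<sigma>) =
    prism_simplex H (p - 1) i (singular_face p j \<sigma>)"
  using assms simplical_face_in_standard_simplex[of "Suc p" j]
    degeneracy_in_standard_simplex[of i "p - 1"]
  by (auto simp: singular_face_def prism_simplex_def fun_eq_iff restrict_def
      degeneracy_face_less sum_simplical_face simp del: sum.lessThan_Suc)

text \<open>Here the zero is inserted beyond the time sum, so the index \<open>i\<close> stays and
  only the face number drops.\<close>

lemma face_prism_simplex_greater:
  assumes "i < j" "j \<le> p"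
  shows "singular_face (Suc p) (Suc j) (prism_simplex H p i \<sigma>) =
    prism_simplex H (p - 1) i (singular_face p j \<sigma>)"
  using assms simplical_face_in_standard_simplex[of "Suc p" "Suc j"]
    degeneracy_in_standard_simplex[of i "p - 1"]
  by (auto simp: singular_face_def prism_simplex_def fun_eq_iff restrict_def
      degeneracy_face_greater sum_simplical_face simp del: sum.lessThan_Suc)

text \<open>The common face of the \<open>(i-1)\<close>-st and the \<open>i\<close>-th simplex of the prism; for \<open>i = 0\<close> and
  \<open>i = p + 1\<close> it is the bottom, respectively the top.\<close>

definition prism_middle :: "('a \<times> real \<Rightarrow> 'b) \<Rightarrow> nat \<Rightarrow> nat \<Rightarrow> ((nat \<Rightarrow> real) \<Rightarrow> 'a) \<Rightarrow> (nat \<Rightarrow> real) \<Rightarrow> 'b" where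
  "prism_middle H p i \<sigma> = restrict (\<lambda>x. H (\<sigma> x, \<Sum>l<i. x l)) (standard_simplex p)"

text \<open>The degeneracy undoes either face inclusion. Only the time differs: a zero at place
  \<open>i\<close> is the last term of the sum, leaving \<open>i\<close> coordinates; a zero at
  \<open>Suc i\<close> lies beyond it.\<close>

lemma face_prism_simplex_middle:
  assumes "i \<le> p"
  shows "singular_face (Suc p) i (prism_simplex H p i \<sigma>) = prism_middle H p i \<sigma>"
    and "singular_face (Suc p) (Suc i) (prism_simplex H p i \<sigma>) = prism_middle H p (Suc i) \<sigma>"
  using assms simplical_face_in_standard_simplex[of "Suc p" i]
    simplical_face_in_standard_simplex[of "Suc p" "Suc i"]
  by (auto simp: singular_face_def prism_simplex_def prism_middle_def fun_eq_iff restrict_def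
      degeneracy_face_eq sum_simplical_face simp del: sum.lessThan_Suc)

text \<open>The empty sum is time 0, and all barycentric coordinates together give time 1.\<close>

lemma prism_middle_ends:
  "prism_middle H p 0 \<sigma> = simplex_map p (\<lambda>x. H (x, 0)) \<sigma>"
  "prism_middle H p (Suc p) \<sigma> = simplex_map p (\<lambda>x. H (x, 1)) \<sigma>"
  by (auto simp: prism_middle_def simplex_map_def fun_eq_iff restrict_def standard_simplex_def
      lessThan_Suc_atMost)

text \<open>The middle faces of the prism simplices telescope to the two ends; the other faces are
  the prism simplices over faces of \<open>\<sigma>\<close> with opposite sign, so they cancel
  \<open>prism H (gboundary c)\<close>.\<close>

lemma prism_homotopy:
  fixes c :: "'a gsimplex \<Rightarrow>\<^sub>0 'r::comm_ring_1"
  shows "gboundary (prism H c) + prism H (gboundary c) =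
    gchain_map (\<lambda>x. H (x, 0)) c - gchain_map (\<lambda>x. H (x, 1)) c"
proof (rule linear_map_eqI[where F = "\<lambda>c. gboundary (prism H c) + prism H (gboundary c)"])
  fix b :: "'a gsimplex"
  obtain p \<sigma> where b: "b = (p, \<sigma>)" by (cases b)
  let ?b = "gen b :: 'a gsimplex \<Rightarrow>\<^sub>0 'r"
  define g :: "nat \<Rightarrow> nat \<Rightarrow> 'b gsimplex \<Rightarrow>\<^sub>0 'r" where
    "g i j = smult_pm ((-1) ^ (i + j)) (gen (p, singular_face (Suc p) j (prism_simplex H p i \<sigma>)))" for i j
  \<comment> \<open>\<open>p - 1\<close> is a genuine predecessor wherever \<open>q\<close> is used:
    all sums of \<open>q\<close> below have \<open>i < p\<close>.\<close>
  define q :: "nat \<Rightarrow> nat \<Rightarrow> 'b gsimplex \<Rightarrow>\<^sub>0 'r" where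
    "q i j = smult_pm ((-1) ^ (i + j)) (gen (p, prism_simplex H (p - 1) i (singular_face p j \<sigma>)))" for i j
  define m :: "nat \<Rightarrow> 'b gsimplex \<Rightarrow>\<^sub>0 'r" where "m i = gen (p, prism_middle H p i \<sigma>)" for i
  have "gboundary (prism H ?b) = (\<Sum>i\<le>p. \<Sum>j\<le>Suc p. g i j)"
    unfolding b prism_gen gboundary_simps gboundary_gen_Suc g_def
    by (simp add: pm.scale_sum_right power_add del: sum.atMost_Suc)
  \<comment> \<open>For fixed \<open>i\<close>, split the face numbers into \<open>j < i\<close>,
    the two middle ones \<open>i\<close> and \<open>Suc i\<close>, and \<open>Suc j\<close> with
    \<open>j > i\<close>.\<close>
  also have "\<dots> = (\<Sum>i\<le>p. (\<Sum>j<i. g i j) + (m i - m (Suc i)) + (\<Sum>j\<in>{i<..p}. g i (Suc j)))"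
  proof (rule sum.cong[OF refl])
    fix i assume "i \<in> {..p}"
    then have i: "i \<le> p" by simp
    have eq: "{..Suc p} = {..<i} \<union> {i, Suc i} \<union> Suc ` {i<..p}"
    proof -
      have "Suc ` {i<..p} = {Suc i<..Suc p}"
        by (metis atLeastSucAtMost_greaterThanAtMost image_Suc_atLeastAtMost)
      then show ?thesis using i by auto
    qed
    have "(\<Sum>j\<le>Suc p. g i j) = (\<Sum>j<i. g i j) + (g i i + g i (Suc i)) + (\<Sum>j\<in>{i<..p}. g i (Suc j))"
      unfolding eq by (subst sum.union_disjoint; (subst sum.union_disjoint)?) (auto simp: sum.reindex)
    moreover have "g i i = m i" "g i (Suc i) = - m (Suc i)"
      using i by (simp_all add: g_def m_def face_prism_simplex_middle power_add flip: power_mult_distrib)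
    ultimately show "(\<Sum>j\<le>Suc p. g i j) = (\<Sum>j<i. g i j) + (m i - m (Suc i)) + (\<Sum>j\<in>{i<..p}. g i (Suc j))"
      by simp
  qed
  also have "\<dots> = (\<Sum>i\<le>p. m i - m (Suc i)) + ((\<Sum>i\<le>p. \<Sum>j<i. g i j) + (\<Sum>i\<le>p. \<Sum>j\<in>{i<..p}. g i (Suc j)))"
    by (simp only: sum.distrib ac_simps)
  also have "(\<Sum>i\<le>p. m i - m (Suc i)) = m 0 - m (Suc p)"
    by (rule sum_telescope)
  \<comment> \<open>There is no \<open>j < 0\<close>, so \<open>i\<close> can be shifted to
    \<open>Suc i\<close>; this shift is the source of the sign between \<open>g\<close> and
    \<open>q\<close>.\<close>
  also have "(\<Sum>i\<le>p. \<Sum>j<i. g i j) = - (\<Sum>i<p. \<Sum>j\<le>i. q i j)"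
  proof -
    have "(\<Sum>i\<le>p. \<Sum>j<i. g i j) = (\<Sum>i<p. \<Sum>j\<le>i. g (Suc i) j)"
      by (subst sum.lessThan_Suc_shift[of _ p, simplified lessThan_Suc_atMost])
        (simp add: lessThan_Suc_atMost)
    also have "\<dots> = - (\<Sum>i<p. \<Sum>j\<le>i. q i j)"
      by (auto simp: g_def q_def face_prism_simplex_less simp flip: sum_negf intro!: sum.cong)
    finally show ?thesis .
  qed
  \<comment> \<open>For \<open>i = p\<close> the inner sum is empty; now the sign comes from the
    face number \<open>Suc j\<close>.\<close>
  also have "(\<Sum>i\<le>p. \<Sum>j\<in>{i<..p}. g i (Suc j)) = - (\<Sum>i<p. \<Sum>j\<in>{i<..p}. q i j)"
  proof -
    have "(\<Sum>i\<le>p. \<Sum>j\<in>{i<..p}. g i (Suc j)) = (\<Sum>i<p. \<Sum>j\<in>{i<..p}. g i (Suc j))"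
      by (rule sum.mono_neutral_right) auto
    also have "\<dots> = - (\<Sum>i<p. \<Sum>j\<in>{i<..p}. q i j)"
      by (auto simp: g_def q_def face_prism_simplex_greater simp flip: sum_negf intro!: sum.cong)
    finally show ?thesis .
  qed
  also have "- (\<Sum>i<p. \<Sum>j\<le>i. q i j) + - (\<Sum>i<p. \<Sum>j\<in>{i<..p}. q i j) = - (\<Sum>i<p. \<Sum>j\<le>p. q i j)"
  proof -
    have "(\<Sum>j\<le>p. q i j) = (\<Sum>j\<le>i. q i j) + (\<Sum>j\<in>{i<..p}. q i j)" if "i < p" for i
      using that by (subst sum.union_disjoint[symmetric]) (auto intro!: sum.cong)
    then show ?thesis by (simp add: sum.distrib)
  qed
  also have "(\<Sum>i<p. \<Sum>j\<le>p. q i j) = prism H (gboundary ?b)"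
  proof (cases p)
    case 0
    then show ?thesis by (simp add: b gboundary_gen linear_map_simps[OF linear_map_prism])
  next
    case (Suc p')
    have "prism H (gboundary ?b) = (\<Sum>j\<le>p. \<Sum>i\<le>p'. q i j)"
      unfolding b Suc gboundary_gen_Suc linear_map_simps[OF linear_map_prism] prism_gen q_def
      by (simp add: pm.scale_sum_right power_add mult.commute del: sum.atMost_Suc)
    also have "\<dots> = (\<Sum>i\<le>p'. \<Sum>j\<le>p. q i j)"
      by (rule sum.swap)
    finally show ?thesis by (simp add: Suc lessThan_Suc_atMost)
  qed
  also have "m 0 - m (Suc p) = gchain_map (\<lambda>x. H (x, 0)) ?b - gchain_map (\<lambda>x. H (x, 1)) ?b"
    by (simp add: m_def b gchain_map_gen prism_middle_ends)
  finally show "gboundary (prism H ?b) + prism H (gboundary ?b) =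
      gchain_map (\<lambda>x. H (x, 0)) ?b - gchain_map (\<lambda>x. H (x, 1)) ?b"
    by simp
qed (rule linear_map_add linear_map_diff linear_map_gchain_map linear_map_comp[OF linear_map_gboundary linear_map_prism]
    linear_map_comp[OF linear_map_prism linear_map_gboundary])+

section \<open>The chain homotopy on the tensor product\<close>

text \<open>The Koszul signs of the tensor product differential are absorbed into the map
  \<open>\<sigma> \<mapsto> (-1)\<^bsup>dim \<sigma>\<^esup> \<sigma>\<close>, applied in the tensor factors to the left of the differentiated one.\<close>

definition grading :: "('a gsimplex \<Rightarrow>\<^sub>0 'r::comm_ring_1) \<Rightarrow> ('a gsimplex \<Rightarrow>\<^sub>0 'r)" where
  "grading = linear_extension (\<lambda>s. smult_pm ((-1) ^ fst s) (gen s))"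

lemma linear_map_grading [simp]: "linear_map grading"
  by (simp add: grading_def)

lemma grading_gen: "grading (gen s) = smult_pm ((-1) ^ fst s) (gen s)"
  by (simp add: grading_def)

lemmas grading_simps = linear_map_simps[OF linear_map_grading]
lemmas prism_simps = linear_map_simps[OF linear_map_prism]

lemma grading_homogeneous:
  "c \<in> free_on {s. fst s = m} \<Longrightarrow> grading c = smult_pm ((-1) ^ m) c"
  by (induction rule: free_on_induct)
    (simp_all add: grading_simps grading_gen pm.scale_right_distrib mult.commute)

lemma grading_grading: "grading (grading c) = c"
proof (rule linear_map_eqI[where F = "\<lambda>c. grading (grading c)" and G = "\<lambda>c. c"])
  show "linear_map (\<lambda>c. grading (grading c))"
    by (rule linear_map_comp) simp_all
qed (simp_all add: grading_simps grading_gen linear_map_id flip: power_mult_distrib)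

lemma gchain_map_grading: "gchain_map h (grading c) = grading (gchain_map h c)"
proof (rule linear_map_eqI[where F = "\<lambda>c. gchain_map h (grading c)" and G = "\<lambda>c. grading (gchain_map h c)"])
  show "gchain_map h (grading (gen b)) = grading (gchain_map h (gen b))" for b
    by (cases b) (simp add: gchain_map_simps grading_gen gchain_map_gen)
qed (rule linear_map_comp; simp)+

lemma gboundary_in_degree: "gboundary (gen s) \<in> free_on {s'. Suc (fst s') = fst s}"
  by (cases s) (auto simp: gboundary_gen intro!: free_on_closed)

text \<open>The boundary lowers the degree by one, which flips the sign; in degree 0 it
  vanishes.\<close>

lemma gboundary_grading: "gboundary (grading c) = - grading (gboundary c)"
proof (rule linear_map_eqI[where F = "\<lambda>c. gboundary (grading c)" and G = "\<lambda>c. - grading (gboundary c)"])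
  have "linear_map (\<lambda>c. 0 - grading (gboundary c))"
    by (intro linear_map_diff linear_map_comp[of grading gboundary]) (auto intro!: linear_mapI)
  then show "linear_map (\<lambda>c. - grading (gboundary c))" by simp
  fix s :: "'a gsimplex"
  let ?s = "gen s :: 'a gsimplex \<Rightarrow>\<^sub>0 'b"
  show "gboundary (grading ?s) = - grading (gboundary ?s)"
  proof (cases "fst s")
    case 0
    then show ?thesis
      by (cases s) (simp add: grading_gen gboundary_simps gboundary_gen grading_simps)
  next
    case (Suc m)
    then have "grading (gboundary ?s) = smult_pm ((-1) ^ m) (gboundary ?s)"
      using gboundary_in_degree[of s] by (intro grading_homogeneous) simp
    then show ?thesis
      by (simp add: grading_gen gboundary_simps Suc)
  qed
qed (rule linear_map_comp; simp)

text \<open>As for the boundary, but here the degree goes up by one.\<close>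

lemma prism_grading: "prism H (grading c) = - grading (prism H c)"
proof (rule linear_map_eqI[where F = "\<lambda>c. prism H (grading c)" and G = "\<lambda>c. - grading (prism H c)"])
  have "linear_map (\<lambda>c. 0 - grading (prism H c))"
    by (intro linear_map_diff linear_map_comp[of grading "prism H"]) (auto intro!: linear_mapI)
  then show "linear_map (\<lambda>c. - grading (prism H c))" by simp
  show "prism H (grading (gen s)) = - grading (prism H (gen s))" for s
    by (cases s) (simp add: grading_gen prism_simps prism_gen grading_simps pm.scale_sum_right mult.commute
        flip: sum_negf)
qed (rule linear_map_comp; simp)

section \<open>The tensor differential as a sum over the factors\<close>

definition boundary_at ::
  "nat \<Rightarrow> nat \<Rightarrow> ('a, 'r::comm_ring_1) tensor_chain \<Rightarrow> ('a, 'r) tensor_chain"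
where
  "boundary_at n i = tensor_map n (\<lambda>j. if j < i then grading else if j = i then gboundary else (\<lambda>x. x))"

lemma linear_map_tensor_boundary [simp]: "linear_map (tensor_boundary n)"
  by (simp add: tensor_boundary_def)

lemma linear_map_tensor_chain_map [simp]: "linear_map (tensor_chain_map n f)"
  by (simp add: tensor_chain_map_def)

lemma tensor_chain_map_eq: "tensor_chain_map n f = tensor_map n (\<lambda>i. gchain_map (f i))"
  by (simp add: tensor_chain_map_def tensor_map_def)

text \<open>By multilinearity the signs that \<open>grading\<close> puts on the factors before
  \<open>i\<close> multiply up to the Koszul sign of the differential.\<close>

lemma tensor_boundary_eq:
  fixes c :: "('a, 'r::comm_ring_1) tensor_chain"
  shows "tensor_boundary n c = (\<Sum>i\<in>{1..n}. boundary_at n i c)"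
proof (rule linear_map_eqI[where G = "\<lambda>c. \<Sum>i\<in>{1..n}. boundary_at n i c"])
  fix \<tau> :: "nat \<Rightarrow> 'a gsimplex"
  have "smult_pm ((-1) ^ (\<Sum>j\<in>{1..<i}. fst (\<tau> j)))
        (tensor n ((\<lambda>j. gen (\<tau> j))(i := gboundary (gen (\<tau> i))))) = boundary_at n i (gen \<tau> :: ('a, 'r) tensor_chain)"
    if i: "i \<in> {1..n}" for i
  proof -
    define r :: "nat \<Rightarrow> 'r" where "r j = (if j < i then (-1) ^ fst (\<tau> j) else 1)" for j
    have "(\<Prod>j\<in>{1..n}. r j) = (\<Prod>j\<in>{1..<i}. r j)"
      using i by (intro prod.mono_neutral_right) (auto simp: r_def)
    also have "\<dots> = (-1) ^ (\<Sum>j\<in>{1..<i}. fst (\<tau> j))"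
      by (simp add: r_def power_sum)
    finally have "smult_pm ((-1) ^ (\<Sum>j\<in>{1..<i}. fst (\<tau> j)))
        (tensor n ((\<lambda>j. gen (\<tau> j))(i := gboundary (gen (\<tau> i))))) =
      tensor n (\<lambda>j. smult_pm (r j) (((\<lambda>j. gen (\<tau> j))(i := gboundary (gen (\<tau> i)))) j))"
      unfolding tensor_smult by (simp only:)
    also have "\<dots> = boundary_at n i (gen \<tau>)"
      unfolding boundary_at_def tensor_map_gen
      by (rule tensor_cong) (auto simp: r_def grading_gen)
    finally show ?thesis .
  qed
  then show "tensor_boundary n (gen \<tau>) = (\<Sum>i\<in>{1..n}. boundary_at n i (gen \<tau> :: ('a, 'r) tensor_chain))"
    unfolding tensor_boundary_def linear_extension_gen by (intro sum.cong) auto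
qed (auto simp: boundary_at_def intro!: linear_map_sum)

lemma tensor_boundary_chain_map:
  "tensor_boundary n (tensor_chain_map n f c) = tensor_chain_map n f (tensor_boundary n c)"
proof -
  have "boundary_at n i (tensor_chain_map n f c) = tensor_chain_map n f (boundary_at n i c)" for i
    unfolding boundary_at_def tensor_chain_map_eq
    by (subst (1 2) tensor_map_comp)
      (auto simp: linear_map_id gboundary_gchain_map gchain_map_grading intro!: tensor_map_cong)
  then show ?thesis
    by (simp add: tensor_boundary_eq linear_map_simps[OF linear_map_tensor_chain_map])
qed

text \<open>A staircase: the end at time 0 before factor \<open>k\<close>, the end at time 1 after
  it, so that the diagonal contributions telescope. \<open>grading\<close> supplies the Koszul sign
  of the degree-one map \<open>prism\<close>.\<close>

definition prism_at ::
  "nat \<Rightarrow> (nat \<Rightarrow> 'a \<times> real \<Rightarrow> 'b) \<Rightarrow> nat \<Rightarrow> ('a, 'r::comm_ring_1) tensor_chain \<Rightarrow> ('b, 'r) tensor_chain"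
where
  "prism_at n H k = tensor_map n (\<lambda>j.
     if j < k then (\<lambda>x. grading (gchain_map (\<lambda>x. H j (x, 0)) x))
     else if j = k then prism (H j) else gchain_map (\<lambda>x. H j (x, 1)))"

definition tensor_prism ::
  "nat \<Rightarrow> (nat \<Rightarrow> 'a \<times> real \<Rightarrow> 'b) \<Rightarrow> ('a, 'r::comm_ring_1) tensor_chain \<Rightarrow> ('b, 'r) tensor_chain"
where
  "tensor_prism n H c = (\<Sum>k\<in>{1..n}. prism_at n H k c)"

lemma linear_map_tensor_prism [simp]: "linear_map (tensor_prism n H)"
  unfolding tensor_prism_def prism_at_def by (rule linear_map_sum) simp

lemma boundary_at_prism_at:
  "boundary_at n i (prism_at n H k c) = tensor_map n (\<lambda>j x.
     (if j < i then grading else if j = i then gboundary else (\<lambda>x. x))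
     ((if j < k then (\<lambda>x. grading (gchain_map (\<lambda>x. H j (x, 0)) x))
       else if j = k then prism (H j) else gchain_map (\<lambda>x. H j (x, 1))) x)) c"
  unfolding boundary_at_def prism_at_def by (rule tensor_map_comp) (simp add: linear_map_id)

lemma prism_at_boundary_at:
  "prism_at n H k (boundary_at n i c) = tensor_map n (\<lambda>j x.
     (if j < k then (\<lambda>x. grading (gchain_map (\<lambda>x. H j (x, 0)) x))
       else if j = k then prism (H j) else gchain_map (\<lambda>x. H j (x, 1)))
     ((if j < i then grading else if j = i then gboundary else (\<lambda>x. x)) x)) c"
  unfolding boundary_at_def prism_at_def
  by (rule tensor_map_comp) (simp add: linear_map_comp[OF linear_map_grading linear_map_gchain_map])

text \<open>The sign arises in factor \<open>min i k\<close>: there \<open>gboundary\<close> or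
  \<open>prism\<close> meets \<open>grading\<close>, with which it anticommutes. In all other
  factors the two composites agree.\<close>

lemma boundary_prism_anticommute:
  assumes "i \<in> {1..n}" "k \<in> {1..n}" "i \<noteq> k"
  shows "boundary_at n i (prism_at n H k c) + prism_at n H k (boundary_at n i c) = 0"
  unfolding boundary_at_prism_at prism_at_boundary_at
proof (rule tensor_map_cancel[where k = "min i k"])
qed (use assms in \<open>auto simp: min_def gboundary_grading gboundary_gchain_map grading_grading gchain_map_grading
  prism_grading\<close>)

text \<open>Before \<open>k\<close> the two gradings cancel, and in factor \<open>k\<close> the
  prism identity gives a difference of ends. \<open>W m\<close> takes the end at time 0 exactly in
  the factors before \<open>m\<close>, so \<open>W (Suc k)\<close> and \<open>W k\<close> differ in
  factor \<open>k\<close> alone.\<close>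

lemma boundary_prism_diagonal:
  fixes H :: "nat \<Rightarrow> 'a \<times> real \<Rightarrow> 'b"
  assumes k: "k \<in> {1..n}"
  defines "W \<equiv> \<lambda>m. tensor_map n (\<lambda>j. gchain_map (\<lambda>x. H j (x, if j < m then 0 else 1)))"
  shows "boundary_at n k (prism_at n H k c) + prism_at n H k (boundary_at n k c) = W (Suc k) c - W k c"
proof -
  let ?\<theta> = "\<lambda>j c. if j = k then gchain_map (\<lambda>x. H j (x, 0)) c - gchain_map (\<lambda>x. H j (x, 1)) c
    else gchain_map (\<lambda>x. H j (x, if j < k then 0 else 1)) c"
  have "boundary_at n k (prism_at n H k c) + prism_at n H k (boundary_at n k c) = tensor_map n ?\<theta> c"
    unfolding boundary_at_prism_at prism_at_boundary_at
    by (rule tensor_map_add[OF k]) (auto simp: prism_homotopy grading_grading gchain_map_grading)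
  moreover have "tensor_map n ?\<theta> c + W k c = W (Suc k) c"
    unfolding W_def by (rule tensor_map_add[OF k]) auto
  ultimately show ?thesis by (simp add: algebra_simps)
qed

text \<open>In the double sum over \<open>i\<close> and \<open>k\<close> only the diagonal survives,
  and it telescopes between \<open>W 1\<close>, all factors at time 1, and \<open>W (Suc n)\<close>,
  all at time 0.\<close>

lemma tensor_prism_homotopy:
  "tensor_boundary n (tensor_prism n H c) + tensor_prism n H (tensor_boundary n c) =
   tensor_chain_map n (\<lambda>i x. H i (x, 0)) c - tensor_chain_map n (\<lambda>i x. H i (x, 1)) c"
proof -
  define M where "M i k = boundary_at n i (prism_at n H k c) + prism_at n H k (boundary_at n i c)" for i k
  define W where "W m = tensor_map n (\<lambda>j. gchain_map (\<lambda>x. H j (x, if j < m then 0 else 1))) c" for m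
  have lin: "linear_map (boundary_at n i)" "linear_map (prism_at n H k)" for i k
    by (simp_all add: boundary_at_def prism_at_def)
  have "tensor_boundary n (tensor_prism n H c) + tensor_prism n H (tensor_boundary n c) =
      (\<Sum>i\<in>{1..n}. \<Sum>k\<in>{1..n}. boundary_at n i (prism_at n H k c)) +
      (\<Sum>k\<in>{1..n}. \<Sum>i\<in>{1..n}. prism_at n H k (boundary_at n i c))"
    by (simp add: tensor_boundary_eq tensor_prism_def linear_map_simps[OF lin(1)] linear_map_simps[OF lin(2)])
  also have "(\<Sum>k\<in>{1..n}. \<Sum>i\<in>{1..n}. prism_at n H k (boundary_at n i c)) =
      (\<Sum>i\<in>{1..n}. \<Sum>k\<in>{1..n}. prism_at n H k (boundary_at n i c))"
    by (rule sum.swap)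
  also have "(\<Sum>i\<in>{1..n}. \<Sum>k\<in>{1..n}. boundary_at n i (prism_at n H k c)) + \<dots> = (\<Sum>i\<in>{1..n}. \<Sum>k\<in>{1..n}. M i k)"
    by (simp add: M_def sum.distrib)
  also have "\<dots> = (\<Sum>i\<in>{1..n}. W (Suc i) - W i)"
  proof (rule sum.cong[OF refl])
    fix i assume i: "i \<in> {1..n}"
    have "(\<Sum>k\<in>{1..n}. M i k) = (\<Sum>k\<in>{i}. M i k)"
      by (rule sum.mono_neutral_right) (use i in \<open>auto simp: M_def boundary_prism_anticommute\<close>)
    also have "\<dots> = W (Suc i) - W i"
      unfolding M_def W_def using boundary_prism_diagonal[OF i] by simp
    finally show "(\<Sum>k\<in>{1..n}. M i k) = W (Suc i) - W i" .
  qed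
  also have "\<dots> = W (Suc n) - W 1"
    by (rule sum_Suc_diff) simp
  also have "W (Suc n) = tensor_chain_map n (\<lambda>i x. H i (x, 0)) c"
    unfolding W_def tensor_chain_map_eq by (rule tensor_map_cong) simp
  also have "W 1 = tensor_chain_map n (\<lambda>i x. H i (x, 1)) c"
    unfolding W_def tensor_chain_map_eq by (rule tensor_map_cong) simp
  finally show ?thesis .
qed

section \<open>Supports\<close>

definition noninteracting_tuples :: "nat \<Rightarrow> 'a topology \<Rightarrow> (nat \<Rightarrow> 'a set) \<Rightarrow> nat \<Rightarrow> (nat \<Rightarrow> 'a gsimplex) set" where
  "noninteracting_tuples n X A p =
     {\<tau> \<in> simplex_tuples n X A p. (\<Inter>i\<in>{1..n}. gsimplex_image (\<tau> i)) = {}}"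

text \<open>An extensional tuple gives a single generator, so \<open>T\<close> is free on part of
  the basis of the tensor product. Membership in \<open>T\<close> becomes a condition on
  supports.\<close>

lemma noninteracting_eq:
  "noninteracting n X A p = (free_on (noninteracting_tuples n X A p) :: ('a, 'r::comm_ring_1) tensor_chain set)"
proof -
  have "simplex_tensor n \<tau> = (gen \<tau> :: ('a, 'r) tensor_chain)" if "\<tau> \<in> simplex_tuples n X A p" for \<tau>
  proof -
    have "restrict \<tau> {1..n} = \<tau>"
      using that unfolding simplex_tuples_def by (blast intro: PiE_restrict)
    then show ?thesis by (simp only: simplex_tensor_def tensor_gen)
  qed
  then have "{simplex_tensor n \<tau> |\<tau>. \<tau> \<in> simplex_tuples n X A p \<and> (\<Inter>i\<in>{1..n}. gsimplex_image (\<tau> i)) = {}}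
      = (gen :: _ \<Rightarrow> ('a, 'r) tensor_chain) ` noninteracting_tuples n X A p"
    unfolding noninteracting_tuples_def by (force simp: image_iff)
  then show ?thesis
    unfolding noninteracting_def free_on_span by (simp only:)
qed

section \<open>Supports in a single factor\<close>

lemma gsimplex_image_subset:
  "s \<in> gsimplices (subtopology X S) \<Longrightarrow> gsimplex_image s \<subseteq> S"
  by (cases s) (auto simp: gsimplices_def singular_simplex_subtopology gsimplex_image_def)

text \<open>A face is the simplex composed with a face inclusion. The degree condition is phrased
  with \<open>Suc\<close>, so the support is empty in degree 0.\<close>

lemma gboundary_free_on:
  assumes "s \<in> gsimplices Z"
  shows "gboundary (gen s) \<in>
    free_on {s' \<in> gsimplices Z. Suc (fst s') = fst s \<and> gsimplex_image s' \<subseteq> gsimplex_image s}"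
proof (cases s)
  case (Pair p \<sigma>)
  have "(p - Suc 0, singular_face p k \<sigma>) \<in>
      {s' \<in> gsimplices Z. Suc (fst s') = fst s \<and> gsimplex_image s' \<subseteq> gsimplex_image s}"
    if "0 < p" "k \<le> p" for k
    using assms that simplical_face_in_standard_simplex[of p k] singular_simplex_singular_face[of p Z \<sigma> k]
    by (auto simp: Pair gsimplices_def gsimplex_image_def singular_face_def)
  then show ?thesis
    unfolding Pair gboundary_gen by (auto intro!: free_on_closed free_on_gen)
qed

lemma gchain_map_free_on:
  assumes "s \<in> gsimplices Z" "continuous_map Z Z' h"
  shows "gchain_map h (gen s) \<in>
    free_on {s' \<in> gsimplices Z'. fst s' = fst s \<and> gsimplex_image s' \<subseteq> h ` gsimplex_image s}"
proof (cases s)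
  case (Pair p \<sigma>)
  then show ?thesis
    using assms singular_simplex_simplex_map[of p Z \<sigma> Z' h]
    by (auto simp: gchain_map_gen gsimplices_def gsimplex_image_def simplex_map_def intro!: free_on_gen)
qed

lemma continuous_map_degeneracy:
  assumes "i \<le> p"
  shows "continuous_map (subtopology (powertop_real UNIV) (standard_simplex (Suc p)))
    (subtopology (powertop_real UNIV) (standard_simplex p)) (degeneracy i)"
proof -
  have "continuous_map (powertop_real UNIV) euclideanreal (\<lambda>x. degeneracy i x k)" for k
    by (cases k i rule: linorder_cases)
      (auto simp: degeneracy_def intro!: continuous_map_product_projection continuous_map_add)
  then show ?thesis
    using degeneracy_in_standard_simplex[OF assms]
    by (auto simp: continuous_map_in_subtopology continuous_map_componentwise_UNIV
        intro!: continuous_map_from_subtopology)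
qed

lemma sum_prefix_in_unit_interval:
  "x \<in> standard_simplex p \<Longrightarrow> (\<Sum>l<m. x l) \<in> {0..1}"
  using sum_standard_simplex_le_1[of x p "{..<m}"] by (auto simp: standard_simplex_def intro!: sum_nonneg)

lemma singular_simplex_prism:
  assumes H: "continuous_map (prod_topology Z (top_of_set {0..1})) Z' H"
    and \<sigma>: "singular_simplex p Z \<sigma>" and "i \<le> p"
  shows "singular_simplex (Suc p) Z' (prism_simplex H p i \<sigma>)"
proof -
  let ?D = "subtopology (powertop_real UNIV) (standard_simplex (Suc p))"
  have "continuous_map ?D euclideanreal (\<lambda>x. \<Sum>l<Suc i. x l)"
    by (intro continuous_map_sum continuous_map_from_subtopology continuous_map_product_projection) auto
  then have "continuous_map ?D (top_of_set {0..1}) (\<lambda>x. \<Sum>l<Suc i. x l)"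
    using sum_prefix_in_unit_interval[where m = "Suc i"]
    by (simp add: continuous_map_in_subtopology image_subset_iff Pi_iff del: sum.lessThan_Suc)
  moreover have "continuous_map ?D Z (\<lambda>x. \<sigma> (degeneracy i x))"
    using continuous_map_compose[OF continuous_map_degeneracy[OF \<open>i \<le> p\<close>], of Z \<sigma>] \<sigma>
    by (simp add: singular_simplex_def o_def)
  ultimately have "continuous_map ?D (prod_topology Z (top_of_set {0..1}))
      (\<lambda>x. (\<sigma> (degeneracy i x), \<Sum>l<Suc i. x l))"
    by (simp add: continuous_map_pairwise o_def del: sum.lessThan_Suc)
  from continuous_map_compose[OF this H] show ?thesis
    unfolding singular_simplex_def prism_simplex_def
    by (auto simp: o_def elim!: continuous_map_eq)
qed

lemma prism_free_on:
  assumes "s \<in> gsimplices Z" "continuous_map (prod_topology Z (top_of_set {0..1})) Z' H"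
  shows "prism H (gen s) \<in>
    free_on {s' \<in> gsimplices Z'. fst s' = Suc (fst s) \<and> gsimplex_image s' \<subseteq> H ` (gsimplex_image s \<times> {0..1})}"
proof (cases s)
  case (Pair p \<sigma>)
  have "(Suc p, prism_simplex H p i \<sigma>) \<in>
      {s' \<in> gsimplices Z'. fst s' = Suc (fst s) \<and> gsimplex_image s' \<subseteq> H ` (gsimplex_image s \<times> {0..1})}"
    if "i \<le> p" for i
  proof -
    have "H (\<sigma> (degeneracy i x), \<Sum>l<Suc i. x l) \<in> H ` (\<sigma> ` standard_simplex p \<times> {0..1})"
      if x: "x \<in> standard_simplex (Suc p)" for x
      by (intro imageI SigmaI degeneracy_in_standard_simplex[OF \<open>i \<le> p\<close> x] sum_prefix_in_unit_interval[OF x])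
    then show ?thesis
      using singular_simplex_prism[OF assms(2) _ that, of \<sigma>] assms(1)
      by (auto simp: Pair gsimplices_def gsimplex_image_def prism_simplex_def simp del: sum.lessThan_Suc)
  qed
  then show ?thesis
    unfolding Pair prism_gen by (auto intro!: free_on_closed free_on_gen)
qed

text \<open>The image bound is weakened from the slice at \<open>t\<close> to the whole cylinder, to
  have the same form as for \<open>prism\<close>.\<close>

lemma gchain_map_slice_free_on:
  assumes "s \<in> gsimplices Z" "continuous_map (prod_topology Z (top_of_set {0..1})) Z' H" "t \<in> {0..1}"
  shows "gchain_map (\<lambda>x. H (x, t)) (gen s) \<in>
    free_on {s' \<in> gsimplices Z'. fst s' = fst s \<and> gsimplex_image s' \<subseteq> H ` (gsimplex_image s \<times> {0..1})}"
proof -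
  have "continuous_map Z (prod_topology Z (top_of_set {0..1})) (\<lambda>x. (x, t))"
    using assms(3) by (auto simp: continuous_map_pairwise o_def)
  from continuous_map_compose[OF this assms(2)] have "continuous_map Z Z' (\<lambda>x. H (x, t))"
    by (simp add: o_def)
  from gchain_map_free_on[OF assms(1) this] show ?thesis
    by (rule subsetD[OF free_on_mono, rotated]) (use assms(3) in auto)
qed

lemma grading_free_on: "c \<in> free_on S \<Longrightarrow> grading c \<in> free_on S"
  by (rule linear_map_free_on[of grading S]) (auto simp: grading_gen intro: free_on_closed)

section \<open>Supports on the tensor product\<close>

lemma simplex_tuplesD:
  assumes "\<tau> \<in> simplex_tuples n X A p"
  shows "i \<in> {1..n} \<Longrightarrow> \<tau> i \<in> gsimplices (subtopology X (A i))" "(\<Sum>i\<in>{1..n}. fst (\<tau> i)) = p"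
  using assms by (auto simp: simplex_tuples_def)

lemma simplex_tuplesI:
  assumes "\<tau> \<in> (\<Pi>\<^sub>E j\<in>{1..n}. U j)" "\<And>j. j \<in> {1..n} \<Longrightarrow> U j \<subseteq> gsimplices (subtopology X (A j))"
    "(\<Sum>i\<in>{1..n}. fst (\<tau> i)) = p"
  shows "\<tau> \<in> simplex_tuples n X A p"
  using assms unfolding simplex_tuples_def by (blast intro: PiE_mono[THEN subsetD])

lemma noninteracting_tuples_subset: "noninteracting_tuples n X A p \<subseteq> simplex_tuples n X A p"
  by (auto simp: noninteracting_tuples_def)

definition boundary_support ::
  "'a topology \<Rightarrow> (nat \<Rightarrow> 'a set) \<Rightarrow> nat \<Rightarrow> nat \<Rightarrow> 'a gsimplex \<Rightarrow> 'a gsimplex set"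
where
  "boundary_support X A i j s = {s' \<in> gsimplices (subtopology X (A j)).
     fst s = (if j = i then Suc (fst s') else fst s') \<and> gsimplex_image s' \<subseteq> gsimplex_image s}"

lemma boundary_at_supported:
  fixes c :: "('a, 'r::comm_ring_1) tensor_chain"
  assumes "c \<in> free_on S" "S \<subseteq> simplex_tuples n X A p"
    and "\<And>\<tau>. \<tau> \<in> S \<Longrightarrow> (\<Pi>\<^sub>E j\<in>{1..n}. boundary_support X A i j (\<tau> j)) \<subseteq> S'"
  shows "boundary_at n i c \<in> free_on S'"
  unfolding boundary_at_def
proof (rule tensor_map_free_on[OF assms(1), where U = "boundary_support X A i"])
  fix \<tau> j assume "\<tau> \<in> S" and j: "j \<in> {1..n}"
  then have \<tau>: "\<tau> j \<in> gsimplices (subtopology X (A j))"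
    using assms(2) simplex_tuplesD(1) by blast
  show "(if j < i then grading else if j = i then gboundary else (\<lambda>x. x)) (gen (\<tau> j) :: _ \<Rightarrow>\<^sub>0 'r)
      \<in> free_on (boundary_support X A i j (\<tau> j))"
  proof (cases "j = i")
    case True
    have "gboundary (gen (\<tau> j) :: _ \<Rightarrow>\<^sub>0 'r) \<in> free_on (boundary_support X A i j (\<tau> j))"
      by (rule subsetD[OF free_on_mono gboundary_free_on[OF \<tau>]]) (auto simp: boundary_support_def True)
    then show ?thesis using True by simp
  next
    case False
    then have "(gen (\<tau> j) :: _ \<Rightarrow>\<^sub>0 'r) \<in> free_on (boundary_support X A i j (\<tau> j))"
      by (intro free_on_gen) (simp add: \<tau> boundary_support_def)
    then show ?thesis using False by (simp add: grading_free_on)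
  qed
qed (rule assms(3))

lemma boundary_support_degree:
  assumes "\<rho> \<in> (\<Pi>\<^sub>E j\<in>{1..n}. boundary_support X A i j (\<tau> j))" "i \<in> {1..n}"
  shows "(\<Sum>j\<in>{1..n}. fst (\<tau> j)) = Suc (\<Sum>j\<in>{1..n}. fst (\<rho> j))"
proof -
  have "(\<Sum>j\<in>{1..n}. fst (\<tau> j)) = (\<Sum>j\<in>{1..n}. fst (\<rho> j) + (if j = i then 1 else 0))"
  proof (rule sum.cong[OF refl])
    fix j assume "j \<in> {1..n}"
    then have "\<rho> j \<in> boundary_support X A i j (\<tau> j)" using assms(1) by blast
    then show "fst (\<tau> j) = fst (\<rho> j) + (if j = i then 1 else 0)"
      by (simp add: boundary_support_def split: if_splits)
  qed
  also have "\<dots> = Suc (\<Sum>j\<in>{1..n}. fst (\<rho> j))"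
    using assms(2) by (simp add: sum.distrib)
  finally show ?thesis .
qed

lemma boundary_support_tuples:
  assumes "\<tau> \<in> simplex_tuples n X A (Suc p)" "i \<in> {1..n}"
  shows "(\<Pi>\<^sub>E j\<in>{1..n}. boundary_support X A i j (\<tau> j)) \<subseteq> simplex_tuples n X A p"
proof
  fix \<rho> assume \<rho>: "\<rho> \<in> (\<Pi>\<^sub>E j\<in>{1..n}. boundary_support X A i j (\<tau> j))"
  then show "\<rho> \<in> simplex_tuples n X A p"
    by (rule simplex_tuplesI)
      (use boundary_support_degree[OF \<rho> assms(2)] simplex_tuplesD(2)[OF assms(1)] in
        \<open>auto simp: boundary_support_def\<close>)
qed

text \<open>Any tuple in the boundary would have total degree one less, which is impossible in
  degree 0: all supports are empty.\<close>

lemma tensor_boundary_degree_0: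
  assumes "c \<in> free_on (simplex_tuples n X A 0)"
  shows "tensor_boundary n c = 0"
proof -
  have "(\<Pi>\<^sub>E j\<in>{1..n}. boundary_support X A i j (\<tau> j)) \<subseteq> {}"
    if "\<tau> \<in> simplex_tuples n X A 0" "i \<in> {1..n}" for i \<tau>
  proof
    fix \<rho> assume "\<rho> \<in> (\<Pi>\<^sub>E j\<in>{1..n}. boundary_support X A i j (\<tau> j))"
    from boundary_support_degree[OF this that(2)] show "\<rho> \<in> {}"
      using simplex_tuplesD(2)[OF that(1)] by simp
  qed
  then have "tensor_boundary n c \<in> free_on {}"
    unfolding tensor_boundary_eq
    by (intro free_on_closed boundary_at_supported[OF assms order_refl])
  then show ?thesis by (simp add: free_on_def)
qed

text \<open>Faces have smaller images, so an empty intersection stays empty. This makes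
  \<open>T\<close> a subcomplex and \<open>IS_boundary\<close> well defined.\<close>

lemma tensor_boundary_noninteracting:
  assumes "c \<in> noninteracting n X A (Suc p)"
  shows "tensor_boundary n c \<in> noninteracting n X A p"
proof -
  have "(\<Pi>\<^sub>E j\<in>{1..n}. boundary_support X A i j (\<tau> j)) \<subseteq> noninteracting_tuples n X A p"
    if \<tau>: "\<tau> \<in> noninteracting_tuples n X A (Suc p)" and i: "i \<in> {1..n}" for i \<tau>
  proof
    fix \<rho> assume \<rho>: "\<rho> \<in> (\<Pi>\<^sub>E j\<in>{1..n}. boundary_support X A i j (\<tau> j))"
    then have "gsimplex_image (\<rho> j) \<subseteq> gsimplex_image (\<tau> j)" if "j \<in> {1..n}" for j
      using PiE_mem[OF \<rho> that] by (simp add: boundary_support_def)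
    then have "(\<Inter>j\<in>{1..n}. gsimplex_image (\<rho> j)) \<subseteq> (\<Inter>j\<in>{1..n}. gsimplex_image (\<tau> j))"
      by blast
    moreover have "\<rho> \<in> simplex_tuples n X A p"
      using boundary_support_tuples[OF _ i] \<tau> \<rho> unfolding noninteracting_tuples_def by blast
    ultimately show "\<rho> \<in> noninteracting_tuples n X A p"
      using \<tau> unfolding noninteracting_tuples_def by blast
  qed
  then show ?thesis
    unfolding noninteracting_eq tensor_boundary_eq
    by (intro free_on_closed boundary_at_supported[OF assms[unfolded noninteracting_eq] noninteracting_tuples_subset])
qed

text \<open>A common point of the \<open>E i\<close> has a preimage in each \<open>C i\<close>; the
  last assumption forces these preimages to coincide, giving a common point of the
  \<open>C i\<close>.\<close>

lemma image_INT_empty: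
  fixes n :: nat
  assumes "n \<ge> 1" "\<And>i. i \<in> {1..n} \<Longrightarrow> C i \<subseteq> D i" "(\<Inter>i\<in>{1..n}. C i) = {}"
    and "\<And>i. i \<in> {1..n} \<Longrightarrow> E i \<subseteq> h i ` C i"
    and "\<And>i j x y. i \<in> {1..n} \<Longrightarrow> j \<in> {1..n} \<Longrightarrow> x \<in> D i \<Longrightarrow> y \<in> D j \<Longrightarrow> h i x = h j y \<Longrightarrow> x = y"
  shows "(\<Inter>i\<in>{1..n}. E i) = {}"
proof (rule ccontr)
  assume "(\<Inter>i\<in>{1..n}. E i) \<noteq> {}"
  then obtain y where "\<And>i. i \<in> {1..n} \<Longrightarrow> y \<in> h i ` C i" using assms(4) by blast
  then have "\<forall>i\<in>{1..n}. \<exists>x\<in>C i. y = h i x" by blast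
  then obtain x where x: "\<And>i. i \<in> {1..n} \<Longrightarrow> x i \<in> C i \<and> y = h i (x i)" by metis
  \<comment> \<open>The preimage with index 1 is the reference to which the others are
    compared.\<close>
  have "1 \<in> {1..n}" using assms(1) by simp
  have "x 1 \<in> C i" if i: "i \<in> {1..n}" for i
  proof -
    have "x 1 = x i"
      by (rule assms(5)[OF \<open>1 \<in> {1..n}\<close> i]) (use x[OF i] x[OF \<open>1 \<in> {1..n}\<close>] assms(2)[OF i] assms(2)[OF \<open>1 \<in> {1..n}\<close>] in auto)
    then show ?thesis using x[OF i] by simp
  qed
  then show False using assms(3) by blast
qed

definition chain_map_support ::
  "'b topology \<Rightarrow> (nat \<Rightarrow> 'b set) \<Rightarrow> (nat \<Rightarrow> 'a \<Rightarrow> 'b) \<Rightarrow> nat \<Rightarrow> 'a gsimplex \<Rightarrow> 'b gsimplex set"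
where
  "chain_map_support Y B f j s = {s' \<in> gsimplices (subtopology Y (B j)).
     fst s' = fst s \<and> gsimplex_image s' \<subseteq> f j ` gsimplex_image s}"

lemma tensor_chain_map_supported:
  fixes c :: "('a, 'r::comm_ring_1) tensor_chain"
  assumes f: "interaction_morphism n X A Y B f"
    and "c \<in> free_on S" "S \<subseteq> simplex_tuples n X A p"
    and "\<And>\<tau>. \<tau> \<in> S \<Longrightarrow> (\<Pi>\<^sub>E j\<in>{1..n}. chain_map_support Y B f j (\<tau> j)) \<subseteq> S'"
  shows "tensor_chain_map n f c \<in> free_on S'"
  unfolding tensor_chain_map_eq
proof (rule tensor_map_free_on[OF assms(2), where U = "chain_map_support Y B f"])
  fix \<tau> j assume "\<tau> \<in> S" and j: "j \<in> {1..n}"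
  then have \<tau>: "\<tau> j \<in> gsimplices (subtopology X (A j))"
    using assms(3) simplex_tuplesD(1) by blast
  show "gchain_map (f j) (gen (\<tau> j) :: _ \<Rightarrow>\<^sub>0 'r) \<in> free_on (chain_map_support Y B f j (\<tau> j))"
    unfolding chain_map_support_def
    by (rule gchain_map_free_on[OF \<tau>]) (use f j in \<open>simp add: interaction_morphism_def\<close>)
qed (rule assms(4))

lemma chain_map_support_tuples:
  assumes "\<tau> \<in> simplex_tuples n X A p"
  shows "(\<Pi>\<^sub>E j\<in>{1..n}. chain_map_support Y B f j (\<tau> j)) \<subseteq> simplex_tuples n Y B p"
proof
  fix \<rho> assume \<rho>: "\<rho> \<in> (\<Pi>\<^sub>E j\<in>{1..n}. chain_map_support Y B f j (\<tau> j))"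
  have "fst (\<rho> j) = fst (\<tau> j)" if "j \<in> {1..n}" for j
    using PiE_mem[OF \<rho> that] by (simp add: chain_map_support_def)
  then have "(\<Sum>j\<in>{1..n}. fst (\<rho> j)) = p"
    unfolding simplex_tuplesD(2)[OF assms, symmetric] by (rule sum.cong[OF refl])
  then show "\<rho> \<in> simplex_tuples n Y B p"
    by (intro simplex_tuplesI[OF \<rho>]) (auto simp: chain_map_support_def)
qed

lemma tensor_chain_map_free_on:
  assumes "interaction_morphism n X A Y B f" "c \<in> free_on (simplex_tuples n X A p)"
  shows "tensor_chain_map n f c \<in> free_on (simplex_tuples n Y B p)"
  by (intro tensor_chain_map_supported[OF assms order_refl] chain_map_support_tuples)

text \<open>Injectivity across components, that \<open>f i x = f j y\<close> forces
  \<open>x = y\<close>, transports emptiness of the intersection from \<open>X\<close> to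
  \<open>Y\<close>.\<close>

lemma tensor_chain_map_noninteracting:
  assumes "n \<ge> 1" and f: "interaction_morphism n X A Y B f" and c: "c \<in> noninteracting n X A p"
  shows "tensor_chain_map n f c \<in> noninteracting n Y B p"
  unfolding noninteracting_eq
proof (rule tensor_chain_map_supported[OF f c[unfolded noninteracting_eq] noninteracting_tuples_subset])
  fix \<tau> assume \<tau>: "\<tau> \<in> noninteracting_tuples n X A p"
  then have \<tau>': "\<tau> \<in> simplex_tuples n X A p" by (simp add: noninteracting_tuples_def)
  show "(\<Pi>\<^sub>E j\<in>{1..n}. chain_map_support Y B f j (\<tau> j)) \<subseteq> noninteracting_tuples n Y B p"
  proof
    fix \<rho> assume \<rho>: "\<rho> \<in> (\<Pi>\<^sub>E j\<in>{1..n}. chain_map_support Y B f j (\<tau> j))"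
    have "(\<Inter>j\<in>{1..n}. gsimplex_image (\<rho> j)) = {}"
    proof (rule image_INT_empty[where C = "\<lambda>j. gsimplex_image (\<tau> j)" and D = A and h = f])
      show "gsimplex_image (\<tau> j) \<subseteq> A j" if "j \<in> {1..n}" for j
        using gsimplex_image_subset[OF simplex_tuplesD(1)[OF \<tau>' that]] .
      show "(\<Inter>j\<in>{1..n}. gsimplex_image (\<tau> j)) = {}"
        using \<tau> by (simp add: noninteracting_tuples_def)
      show "gsimplex_image (\<rho> j) \<subseteq> f j ` gsimplex_image (\<tau> j)" if "j \<in> {1..n}" for j
        using PiE_mem[OF \<rho> that] by (simp add: chain_map_support_def)
      show "x = y" if "i \<in> {1..n}" "j \<in> {1..n}" "x \<in> A i" "y \<in> A j" "f i x = f j y" for i j x y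
        using f that unfolding interaction_morphism_def by blast
    qed (rule assms(1))
    moreover have "\<rho> \<in> simplex_tuples n Y B p"
      using chain_map_support_tuples[OF \<tau>'] \<rho> by blast
    ultimately show "\<rho> \<in> noninteracting_tuples n Y B p"
      by (simp add: noninteracting_tuples_def)
  qed
qed

text \<open>The image bound involves the full cylinder also for \<open>j \<noteq> k\<close>, where
  just one end of the homotopy acts; all factors can then be compared by the interaction condition
  on \<open>H\<close>.\<close>

definition prism_support ::
  "'b topology \<Rightarrow> (nat \<Rightarrow> 'b set) \<Rightarrow> (nat \<Rightarrow> 'a \<times> real \<Rightarrow> 'b) \<Rightarrow> nat \<Rightarrow> nat \<Rightarrow> 'a gsimplex \<Rightarrow> 'b gsimplex set"
where
  "prism_support Y B H k j s = {s' \<in> gsimplices (subtopology Y (B j)).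
     fst s' = (if j = k then Suc (fst s) else fst s) \<and> gsimplex_image s' \<subseteq> H j ` (gsimplex_image s \<times> {0..1})}"

text \<open>Holds because the subspace \<open>A j \<times> {0..1}\<close> of the cylinder carries
  the product of the subspace topologies.\<close>

lemma interaction_morphism_cylinder_continuous:
  assumes "interaction_morphism n (prod_topology X (top_of_set {0..1::real})) (\<lambda>i. A i \<times> {0..1}) Y B H"
    and "j \<in> {1..n}"
  shows "continuous_map (prod_topology (subtopology X (A j)) (top_of_set {0..1})) (subtopology Y (B j)) (H j)"
proof -
  have "subtopology (prod_topology X (top_of_set {0..1::real})) (A j \<times> {0..1}) =
      prod_topology (subtopology X (A j)) (top_of_set {0..1})"
    by (simp add: subtopology_Times subtopology_subtopology)
  moreover have "continuous_map (subtopology (prod_topology X (top_of_set {0..1::real})) (A j \<times> {0..1}))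
      (subtopology Y (B j)) (H j)"
    using assms by (simp add: interaction_morphism_def)
  ultimately show ?thesis by (simp only:)
qed

lemma prism_at_supported:
  fixes c :: "('a, 'r::comm_ring_1) tensor_chain"
  assumes H: "interaction_morphism n (prod_topology X (top_of_set {0..1::real})) (\<lambda>i. A i \<times> {0..1}) Y B H"
    and "c \<in> free_on S" "S \<subseteq> simplex_tuples n X A p"
    and "\<And>\<tau>. \<tau> \<in> S \<Longrightarrow> (\<Pi>\<^sub>E j\<in>{1..n}. prism_support Y B H k j (\<tau> j)) \<subseteq> S'"
  shows "prism_at n H k c \<in> free_on S'"
  unfolding prism_at_def
proof (rule tensor_map_free_on[OF assms(2), where U = "prism_support Y B H k"])
  fix \<tau> j assume "\<tau> \<in> S" and j: "j \<in> {1..n}"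
  then have \<tau>: "\<tau> j \<in> gsimplices (subtopology X (A j))"
    using assms(3) simplex_tuplesD(1) by blast
  note Hj = interaction_morphism_cylinder_continuous[OF H j]
  show "(if j < k then (\<lambda>x. grading (gchain_map (\<lambda>x. H j (x, 0)) x))
      else if j = k then prism (H j) else gchain_map (\<lambda>x. H j (x, 1))) (gen (\<tau> j) :: _ \<Rightarrow>\<^sub>0 'r)
      \<in> free_on (prism_support Y B H k j (\<tau> j))"
  proof (cases "j = k")
    case True
    have "prism (H j) (gen (\<tau> j) :: _ \<Rightarrow>\<^sub>0 'r) \<in> free_on (prism_support Y B H k j (\<tau> j))"
      by (rule subsetD[OF free_on_mono prism_free_on[OF \<tau> Hj]]) (auto simp: prism_support_def True)
    then show ?thesis using True by simp
  next
    case False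
    then have "gchain_map (\<lambda>x. H j (x, t)) (gen (\<tau> j) :: _ \<Rightarrow>\<^sub>0 'r) \<in> free_on (prism_support Y B H k j (\<tau> j))"
      if "t \<in> {0..1}" for t
      by (intro subsetD[OF free_on_mono gchain_map_slice_free_on[OF \<tau> Hj that]]) (auto simp: prism_support_def)
    from this[of 0] this[of 1] show ?thesis
      using False by (simp add: grading_free_on)
  qed
qed (rule assms(4))

lemma prism_support_tuples:
  assumes "\<tau> \<in> simplex_tuples n X A p" "k \<in> {1..n}"
  shows "(\<Pi>\<^sub>E j\<in>{1..n}. prism_support Y B H k j (\<tau> j)) \<subseteq> simplex_tuples n Y B (Suc p)"
proof
  fix \<rho> assume \<rho>: "\<rho> \<in> (\<Pi>\<^sub>E j\<in>{1..n}. prism_support Y B H k j (\<tau> j))"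
  have "(\<Sum>j\<in>{1..n}. fst (\<rho> j)) = (\<Sum>j\<in>{1..n}. fst (\<tau> j) + (if j = k then 1 else 0))"
  proof (rule sum.cong[OF refl])
    fix j assume "j \<in> {1..n}"
    then have "\<rho> j \<in> prism_support Y B H k j (\<tau> j)" using \<rho> by blast
    then show "fst (\<rho> j) = fst (\<tau> j) + (if j = k then 1 else 0)"
      by (simp add: prism_support_def split: if_splits)
  qed
  also have "\<dots> = Suc p"
    using assms(2) simplex_tuplesD(2)[OF assms(1)] by (simp add: sum.distrib)
  finally show "\<rho> \<in> simplex_tuples n Y B (Suc p)"
    by (intro simplex_tuplesI[OF \<rho>]) (auto simp: prism_support_def)
qed

lemma tensor_prism_free_on:
  assumes "interaction_morphism n (prod_topology X (top_of_set {0..1::real})) (\<lambda>i. A i \<times> {0..1}) Y B H"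
    and "c \<in> free_on (simplex_tuples n X A p)"
  shows "tensor_prism n H c \<in> free_on (simplex_tuples n Y B (Suc p))"
  unfolding tensor_prism_def
  by (intro free_on_closed prism_at_supported[OF assms order_refl] prism_support_tuples)

text \<open>Here the interaction condition on \<open>H\<close> is decisive:
  \<open>H i (x, s) = H j (y, t)\<close> forces \<open>x = y\<close> and \<open>s = t\<close>, so
  images of different points never meet, even at different times.\<close>

lemma tensor_prism_noninteracting:
  assumes "n \<ge> 1"
    and H: "interaction_morphism n (prod_topology X (top_of_set {0..1::real})) (\<lambda>i. A i \<times> {0..1}) Y B H"
    and c: "c \<in> noninteracting n X A p"
  shows "tensor_prism n H c \<in> noninteracting n Y B (Suc p)"
proof -
  have "(\<Pi>\<^sub>E j\<in>{1..n}. prism_support Y B H k j (\<tau> j)) \<subseteq> noninteracting_tuples n Y B (Suc p)"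
    if \<tau>: "\<tau> \<in> noninteracting_tuples n X A p" and k: "k \<in> {1..n}" for k \<tau>
  proof
    fix \<rho> assume \<rho>: "\<rho> \<in> (\<Pi>\<^sub>E j\<in>{1..n}. prism_support Y B H k j (\<tau> j))"
    have \<tau>': "\<tau> \<in> simplex_tuples n X A p" using \<tau> by (simp add: noninteracting_tuples_def)
    have "(\<Inter>j\<in>{1..n}. gsimplex_image (\<rho> j)) = {}"
    proof (rule image_INT_empty[where C = "\<lambda>j. gsimplex_image (\<tau> j) \<times> {0..1}"
          and D = "\<lambda>j. A j \<times> {0..1}" and h = H])
      show "gsimplex_image (\<tau> j) \<times> {0..1} \<subseteq> A j \<times> {0..1::real}" if "j \<in> {1..n}" for j
        using gsimplex_image_subset[OF simplex_tuplesD(1)[OF \<tau>' that]] by blast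
      \<comment> \<open>A common point of the products has a first coordinate common to all
        images.\<close>
      show "(\<Inter>j\<in>{1..n}. gsimplex_image (\<tau> j) \<times> {0..1::real}) = {}"
        using \<tau> \<open>n \<ge> 1\<close> unfolding noninteracting_tuples_def by fastforce
      show "gsimplex_image (\<rho> j) \<subseteq> H j ` (gsimplex_image (\<tau> j) \<times> {0..1})" if "j \<in> {1..n}" for j
        using PiE_mem[OF \<rho> that] by (simp add: prism_support_def)
      show "x = y" if "i \<in> {1..n}" "j \<in> {1..n}" "x \<in> A i \<times> {0..1}" "y \<in> A j \<times> {0..1}" "H i x = H j y" for i j x y
        using H that unfolding interaction_morphism_def by blast
    qed (rule assms(1))
    moreover have "\<rho> \<in> simplex_tuples n Y B (Suc p)"
      using prism_support_tuples[OF \<tau>' k] \<rho> by blast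
    ultimately show "\<rho> \<in> noninteracting_tuples n Y B (Suc p)"
      by (simp add: noninteracting_tuples_def)
  qed
  then show ?thesis
    unfolding noninteracting_eq tensor_prism_def
    by (intro free_on_closed prism_at_supported[OF H c[unfolded noninteracting_eq] noninteracting_tuples_subset])
qed

section \<open>Passage to homology\<close>

text \<open>Simplices of \<open>A i\<close> see \<open>f i\<close> on \<open>A i\<close> alone. The
  ends of a homotopy agree with the given morphisms there but may differ elsewhere.\<close>

lemma tensor_chain_map_cong_on:
  fixes c :: "('a, 'r::comm_ring_1) tensor_chain"
  assumes "c \<in> free_on (simplex_tuples n X A p)"
    and "\<And>i x. i \<in> {1..n} \<Longrightarrow> x \<in> A i \<Longrightarrow> f i x = g i x"
  shows "tensor_chain_map n f c = tensor_chain_map n g c"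
  using assms(1)
proof (induction rule: free_on_induct)
  case (add r \<tau> c)
  have "simplex_map (fst (\<tau> i)) (f i) (snd (\<tau> i)) = simplex_map (fst (\<tau> i)) (g i) (snd (\<tau> i))"
    if i: "i \<in> {1..n}" for i
  proof (rule simplex_map_eq)
    show "singular_simplex (fst (\<tau> i)) (subtopology X (A i)) (snd (\<tau> i))"
      using simplex_tuplesD(1)[OF add(1) i] by (auto simp: gsimplices_def)
  qed (use assms(2)[OF i] in auto)
  then have "tensor_chain_map n f (gen \<tau>) = tensor_chain_map n g (gen \<tau> :: ('a, 'r) tensor_chain)"
    unfolding tensor_chain_map_eq tensor_map_gen
    by (intro tensor_cong) (metis gchain_map_gen prod.collapse)
  with add show ?case by (simp add: linear_map_simps[OF linear_map_tensor_chain_map])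
qed (simp add: linear_map_simps[OF linear_map_tensor_chain_map])

section \<open>Cosets of the subcomplex\<close>

definition coset :: "('a, 'r::comm_ring_1) tensor_chain set \<Rightarrow> ('a, 'r) tensor_chain \<Rightarrow> ('a, 'r) tensor_chain set" where
  "coset S x = (\<lambda>h. h + x) ` S"

text \<open>Addition of chains is the same in every \<open>tensor_group\<close>, so cosets can be
  written without reference to space or degree.\<close>

lemma r_coset_tensor_group: "K #>\<^bsub>tensor_group n X A p\<^esub> x = coset K x"
  by (auto simp: r_coset_def tensor_group_def coset_def)

lemma coset_eqI:
  assumes "x - y \<in> free_on S"
  shows "coset (free_on S) x = coset (free_on S) y"
proof -
  have sub: "coset (free_on S) x \<subseteq> coset (free_on S) y" if "x - y \<in> free_on S"
    for x y :: "('a, 'r::comm_ring_1) tensor_chain"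
  proof
    fix v assume "v \<in> coset (free_on S) x"
    then obtain h where "h \<in> free_on S" "v = h + x" by (auto simp: coset_def)
    then have "h + (x - y) \<in> free_on S" "v = (h + (x - y)) + y"
      using that by (auto intro: free_on_closed)
    then show "v \<in> coset (free_on S) y" unfolding coset_def by (rule rev_image_eqI)
  qed
  moreover have "y - x \<in> free_on S" using free_on_closed(4)[OF assms] by simp
  ultimately show ?thesis using assms by blast
qed

lemma coset_add:
  "coset (free_on S) x <#>\<^bsub>tensor_group n X A p\<^esub> coset (free_on S) y = coset (free_on S) (x + y)"
proof
  show "coset (free_on S) x <#>\<^bsub>tensor_group n X A p\<^esub> coset (free_on S) y \<subseteq> coset (free_on S) (x + y)"
  proof
    fix v assume "v \<in> coset (free_on S) x <#>\<^bsub>tensor_group n X A p\<^esub> coset (free_on S) y"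
    then obtain h k where "h \<in> free_on S" "k \<in> free_on S" "v = (h + x) + (k + y)"
      by (auto simp: set_mult_def tensor_group_def coset_def)
    then have "h + k \<in> free_on S" "v = (h + k) + (x + y)"
      by (auto intro: free_on_closed)
    then show "v \<in> coset (free_on S) (x + y)" unfolding coset_def by (rule rev_image_eqI)
  qed
  show "coset (free_on S) (x + y) \<subseteq> coset (free_on S) x <#>\<^bsub>tensor_group n X A p\<^esub> coset (free_on S) y"
  proof
    fix v assume "v \<in> coset (free_on S) (x + y)"
    then obtain h where h: "h \<in> free_on S" "v = h + (x + y)" by (auto simp: coset_def)
    then have "h + x \<in> coset (free_on S) x" "0 + y \<in> coset (free_on S) y" "v = (h + x) + (0 + y)"
      unfolding coset_def by (auto intro!: imageI free_on_closed)
    then show "v \<in> coset (free_on S) x <#>\<^bsub>tensor_group n X A p\<^esub> coset (free_on S) y"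
      unfolding set_mult_def tensor_group_def by auto
  qed
qed

text \<open>\<open>coset_map\<close> picks the only element of a set of cosets. Since
  \<open>\<Phi>\<close> carries \<open>free_on S\<close> into \<open>free_on S'\<close>, all
  representatives give the same coset and this set is a singleton.\<close>

lemma coset_map_coset:
  assumes \<Phi>: "linear_map \<Phi>" and "\<And>h. h \<in> free_on S \<Longrightarrow> \<Phi> h \<in> free_on S'"
  shows "coset_map (tensor_group n X A p) (free_on S') \<Phi> (coset (free_on S) x) = coset (free_on S') (\<Phi> x)"
proof -
  have eq: "coset (free_on S') (\<Phi> (h + x)) = coset (free_on S') (\<Phi> x)" if "h \<in> free_on S" for h
    by (rule coset_eqI) (simp add: linear_map_simps[OF \<Phi>] assms(2) that)
  have "(\<lambda>x. coset (free_on S') (\<Phi> x)) ` coset (free_on S) x = {coset (free_on S') (\<Phi> x)}"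
  proof
    show "(\<lambda>x. coset (free_on S') (\<Phi> x)) ` coset (free_on S) x \<subseteq> {coset (free_on S') (\<Phi> x)}"
      unfolding coset_def[of "free_on S"] using eq by blast
    have "0 + x \<in> coset (free_on S) x" unfolding coset_def by (intro imageI free_on_closed)
    then show "{coset (free_on S') (\<Phi> x)} \<subseteq> (\<lambda>x. coset (free_on S') (\<Phi> x)) ` coset (free_on S) x"
      by auto
  qed
  then show ?thesis by (simp add: coset_map_def r_coset_tensor_group)
qed

section \<open>The interaction complex on representatives\<close>

lemma carrier_IS:
  "carrier (IS n X A p) = coset (noninteracting n X A p) ` free_on (simplex_tuples n X A p)"
proof -
  have "carrier (tensor_group n X A p) = free_on (simplex_tuples n X A p)"
    by (simp add: tensor_group_def)
  then show ?thesis
    by (auto simp: IS_def FactGroup_def RCOSETS_def r_coset_tensor_group)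
qed

lemma mult_IS:
  "coset (noninteracting n X A p) x \<otimes>\<^bsub>IS n X A p\<^esub> coset (noninteracting n X A p) y =
   coset (noninteracting n X A p) (x + y)"
  by (simp add: IS_def FactGroup_def coset_add noninteracting_eq)

lemma IS_boundary_coset:
  "IS_boundary n X A (Suc p) (coset (noninteracting n X A (Suc p)) x) =
   coset (noninteracting n X A p) (tensor_boundary n x)"
  unfolding IS_boundary_def noninteracting_eq diff_Suc_1
  by (rule coset_map_coset) (simp_all add: tensor_boundary_noninteracting flip: noninteracting_eq)

lemma IS_map_coset:
  assumes "n \<ge> 1" "interaction_morphism n X A Y B f"
  shows "IS_map n Y B f p (coset (noninteracting n X A p) x) =
    coset (noninteracting n Y B p) (tensor_chain_map n f x)"
  unfolding IS_map_def noninteracting_eq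
  by (rule coset_map_coset) (simp_all add: tensor_chain_map_noninteracting[OF assms] flip: noninteracting_eq)

lemma IS_boundaries_eq:
  "IS_boundaries n X A p =
   (\<lambda>y. coset (noninteracting n X A p) (tensor_boundary n y)) ` free_on (simplex_tuples n X A (Suc p))"
  by (simp add: IS_boundaries_def carrier_IS image_image IS_boundary_coset)

text \<open>The kernel condition says that the boundary of a representative lies in
  \<open>T\<close>. For \<open>p = 0\<close> it takes the same form with \<open>p - 1 = 0\<close>,
  since the boundary is then 0.\<close>

lemma IS_cyclesE:
  assumes "c \<in> carrier (IS_cycles n X A p)"
  obtains x where "c = coset (noninteracting n X A p) x" "x \<in> free_on (simplex_tuples n X A p)"
    "tensor_boundary n x \<in> noninteracting n X A (p - 1)"
proof (cases p)
  case 0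
  then obtain x where x: "c = coset (noninteracting n X A 0) x" "x \<in> free_on (simplex_tuples n X A 0)"
    using assms by (auto simp: IS_cycles_def carrier_IS)
  with tensor_boundary_degree_0[OF x(2)] show ?thesis
    using that by (simp add: 0 noninteracting_eq free_on_closed)
next
  case (Suc q)
  then obtain x where x: "c = coset (noninteracting n X A p) x" "x \<in> free_on (simplex_tuples n X A p)"
    "IS_boundary n X A p c = noninteracting n X A q"
    using assms by (auto simp: IS_cycles_def kernel_def carrier_IS) (auto simp: IS_def FactGroup_def)
  then have "coset (noninteracting n X A q) (tensor_boundary n x) = noninteracting n X A q"
    by (simp add: Suc IS_boundary_coset)
  \<comment> \<open>As \<open>T\<close> contains 0, the coset contains its representative, which
    therefore lies in \<open>T\<close>.\<close>
  moreover have "0 + tensor_boundary n x \<in> coset (noninteracting n X A q) (tensor_boundary n x)"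
    unfolding coset_def noninteracting_eq by (intro imageI free_on_closed)
  ultimately show ?thesis
    using that x by (simp add: Suc)
qed

lemma IS_boundaries_r_coset:
  fixes v :: "('a, 'r::comm_ring_1) tensor_chain"
  shows "IS_boundaries n X A p #>\<^bsub>IS_cycles n X A p\<^esub> coset (noninteracting n X A p) v =
   (\<lambda>y. coset (noninteracting n X A p) (tensor_boundary n y + v)) ` free_on (simplex_tuples n X A (Suc p))"
proof -
  have "mult (IS_cycles n X A p) = mult (IS n X A p :: ('a, 'r) tensor_chain set monoid)"
    by (simp add: IS_cycles_def)
  then show ?thesis
    by (auto simp: r_coset_def IS_boundaries_eq mult_IS)
qed

text \<open>\<open>coset_map\<close> on homology ranges over all members of a class, so an arbitrary
  member is described: a cycle modulo \<open>T\<close> plus some boundary.\<close>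

lemma interaction_homologyE:
  assumes "z \<in> carrier (interaction_homology n X A p)" "c \<in> z"
  obtains x y where "c = coset (noninteracting n X A p) (tensor_boundary n y + x)"
    "y \<in> free_on (simplex_tuples n X A (Suc p))" "x \<in> free_on (simplex_tuples n X A p)"
    "tensor_boundary n x \<in> noninteracting n X A (p - 1)"
proof -
  obtain c' where c': "c' \<in> carrier (IS_cycles n X A p)" "z = IS_boundaries n X A p #>\<^bsub>IS_cycles n X A p\<^esub> c'"
    using assms(1) by (auto simp: interaction_homology_def FactGroup_def RCOSETS_def)
  obtain x where x: "c' = coset (noninteracting n X A p) x" "x \<in> free_on (simplex_tuples n X A p)"
    "tensor_boundary n x \<in> noninteracting n X A (p - 1)"
    using IS_cyclesE[OF c'(1)] .
  with that assms(2) show ?thesis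
    by (auto simp: c'(2) IS_boundaries_r_coset)
qed

text \<open>Adding \<open>w\<close> to \<open>y\<close> absorbs the difference of \<open>v\<close>
  and \<open>v'\<close> modulo \<open>T\<close>; the reverse inclusion uses
  \<open>- w\<close>.\<close>

lemma IS_boundaries_r_coset_eqI:
  fixes v v' w :: "('a, 'r::comm_ring_1) tensor_chain"
  assumes "w \<in> free_on (simplex_tuples n X A (Suc p))" "v - v' - tensor_boundary n w \<in> noninteracting n X A p"
  shows "IS_boundaries n X A p #>\<^bsub>IS_cycles n X A p\<^esub> coset (noninteracting n X A p) v =
    IS_boundaries n X A p #>\<^bsub>IS_cycles n X A p\<^esub> coset (noninteracting n X A p) v'"
proof -
  note d = linear_map_simps[OF linear_map_tensor_boundary]
  have sub: "IS_boundaries n X A p #>\<^bsub>IS_cycles n X A p\<^esub> coset (noninteracting n X A p) v \<subseteq>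
      IS_boundaries n X A p #>\<^bsub>IS_cycles n X A p\<^esub> coset (noninteracting n X A p) v'"
    if "w \<in> free_on (simplex_tuples n X A (Suc p))" "v - v' - tensor_boundary n w \<in> noninteracting n X A p"
    for v v' w :: "('a, 'r) tensor_chain"
    unfolding IS_boundaries_r_coset
  proof (rule image_subsetI)
    fix y :: "('a, 'r) tensor_chain"
    assume y: "y \<in> free_on (simplex_tuples n X A (Suc p))"
    have "coset (noninteracting n X A p) (tensor_boundary n y + v) =
        coset (noninteracting n X A p) (tensor_boundary n (y + w) + v')"
      unfolding noninteracting_eq
      by (rule coset_eqI) (use that(2) in \<open>simp add: d noninteracting_eq algebra_simps\<close>)
    moreover have "y + w \<in> free_on (simplex_tuples n X A (Suc p))"
      using y that(1) by (rule free_on_closed)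
    ultimately show "coset (noninteracting n X A p) (tensor_boundary n y + v) \<in>
        (\<lambda>y. coset (noninteracting n X A p) (tensor_boundary n y + v')) ` free_on (simplex_tuples n X A (Suc p))"
      by blast
  qed
  have "v' - v - tensor_boundary n (- w) \<in> noninteracting n X A p"
    using free_on_closed(4)[OF assms(2)[unfolded noninteracting_eq]]
    by (simp add: d noninteracting_eq algebra_simps)
  with sub[OF assms] sub[OF free_on_closed(4)[OF assms(1)]] show ?thesis by blast
qed

text \<open>Both maps are read off from the classes of the images of all \<open>c\<close> in
  \<open>z\<close>, so it suffices that the two images of each \<open>c\<close> are
  homologous.\<close>

lemma formal_homotopic_homology_map_eq:
  assumes "n \<ge> 1" and "formal_homotopic n X A Y B f g"
    and z: "z \<in> carrier (interaction_homology n X A p :: ('a, 'r::comm_ring_1) tensor_chain set set monoid)"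
  shows "interaction_homology_map n Y B f p z = interaction_homology_map n Y B g p z"
proof -
  from assms(2) obtain H where f: "interaction_morphism n X A Y B f" and g: "interaction_morphism n X A Y B g"
    and H: "interaction_morphism n (prod_topology X (top_of_set {0..1::real})) (\<lambda>i. A i \<times> {0..1}) Y B H"
    and ends: "\<And>i x. i \<in> {1..n} \<Longrightarrow> x \<in> A i \<Longrightarrow> H i (x, 0) = f i x \<and> H i (x, 1) = g i x"
    unfolding formal_homotopic_def by blast
  have "IS_boundaries n Y B p #>\<^bsub>IS_cycles n Y B p\<^esub> IS_map n Y B f p c =
      IS_boundaries n Y B p #>\<^bsub>IS_cycles n Y B p\<^esub> IS_map n Y B g p c" if "c \<in> z" for c
  proof -
    obtain x y where c: "c = coset (noninteracting n X A p) (tensor_boundary n y + x)"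
      and y: "y \<in> free_on (simplex_tuples n X A (Suc p))" and x: "x \<in> free_on (simplex_tuples n X A p)"
      and dx: "tensor_boundary n x \<in> noninteracting n X A (p - 1)"
      using interaction_homologyE[OF z \<open>c \<in> z\<close>] .
    \<comment> \<open>The part \<open>tensor_boundary n y\<close> accounts for the first summand, as
      \<open>f\<close> and \<open>g\<close> induce chain maps; the chain homotopy accounts for the
      second. What remains is \<open>tensor_prism\<close> of the boundary of \<open>x\<close>, which
      lies in \<open>T\<close>.\<close>
    define w where "w = (tensor_chain_map n f y - tensor_chain_map n g y) + tensor_prism n H x"
    have w: "w \<in> free_on (simplex_tuples n Y B (Suc p))"
      unfolding w_def
      by (intro free_on_closed tensor_chain_map_free_on[OF f y] tensor_chain_map_free_on[OF g y]
          tensor_prism_free_on[OF H x])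
    have "tensor_chain_map n f x - tensor_chain_map n g x =
        tensor_chain_map n (\<lambda>i x. H i (x, 0)) x - tensor_chain_map n (\<lambda>i x. H i (x, 1)) x"
      using tensor_chain_map_cong_on[OF x, of f "\<lambda>i x. H i (x, 0)"]
        tensor_chain_map_cong_on[OF x, of g "\<lambda>i x. H i (x, 1)"] ends by simp
    also have "\<dots> = tensor_boundary n (tensor_prism n H x) + tensor_prism n H (tensor_boundary n x)"
      by (rule tensor_prism_homotopy[symmetric])
    finally have "tensor_chain_map n f (tensor_boundary n y + x) - tensor_chain_map n g (tensor_boundary n y + x)
        - tensor_boundary n w = tensor_prism n H (tensor_boundary n x)"
      by (simp add: w_def linear_map_simps[OF linear_map_tensor_chain_map]
          linear_map_simps[OF linear_map_tensor_boundary] tensor_boundary_chain_map algebra_simps)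
    also have "\<dots> \<in> noninteracting n Y B p"
    \<comment> \<open>For \<open>p = 0\<close> the truncated \<open>p - 1\<close> does not match the
      degree shift of \<open>tensor_prism\<close>, but the boundary of \<open>x\<close> is then
      zero.\<close>
    proof (cases p)
      case 0
      then show ?thesis
        using x
        by (simp add: tensor_boundary_degree_0[of x n X A] linear_map_simps[OF linear_map_tensor_prism] noninteracting_eq free_on_closed)
    next
      case (Suc q)
      then show ?thesis
        using tensor_prism_noninteracting[OF assms(1) H dx] by simp
    qed
    finally show ?thesis
      unfolding c IS_map_coset[OF assms(1) f] IS_map_coset[OF assms(1) g]
      by (rule IS_boundaries_r_coset_eqI[OF w])
  qed
  then show ?thesis
    unfolding interaction_homology_map_def coset_map_def by (metis (no_types, lifting) image_cong)
qed

theorem theorem1p1: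
  fixes X :: "'a topology" and A :: "nat \<Rightarrow> 'a set"
    and Y :: "'b topology" and B :: "nat \<Rightarrow> 'b set"
    and f g :: "nat \<Rightarrow> 'a \<Rightarrow> 'b" and n :: nat
  assumes "n \<ge> 1"
    and "interaction_space n X A" and "interaction_space n Y B"
    and "interaction_morphism n X A Y B f" and "interaction_morphism n X A Y B g"
    and "interaction_homotopic n X A Y B f g"
  shows "\<forall>p. \<forall>z \<in> carrier (interaction_homology n X A p ::
             ('a, 'r::principal_ideal_domain) tensor_chain set set monoid).
           interaction_homology_map n Y B f p z = interaction_homology_map n Y B g p z"
  using assms(6) unfolding interaction_homotopic_def
\<comment> \<open>Equality of induced maps is transitive, so it passes along the chain one formal
  homotopy at a time.\<close>
proof (induction rule: tranclp_induct)
  case (base h)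
  then show ?case using formal_homotopic_homology_map_eq[OF assms(1)] by blast
next
  case (step h k)
  then show ?case using formal_homotopic_homology_map_eq[OF assms(1) step(2)] by metis
qed

end
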